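(* For every $V > 0$, $$\gamma_\ell < \frac{\log \left( 1 + \frac{1}{(2+2V)^2} \right)}{16 \cdot \log \left( \frac{\sqrt{5} + 1}{2} \right)}, \quad \text{and} \quad \gamma_u > 1 + \frac{\log [(5 + 2V)^{1/2} (3 + V) a_V]}{\log \frac{\sqrt{5} + 1}{2}},$$ there are constants $C_\ell, C_u > 0$ such that for every $\omega\in\mathbb{T}$, every $L \ge 1$, and every $E \in \Sigma_V$, every solution $u$ to the difference equation $H_{V,\omega} u = E u$ which is normalized by $|u(0)|^2 + |u(1)|^2 = 1$ obeys the estimates $$C_\ell L^{\gamma_\ell} \le \|u\|_L \le C_u L^{\gamma_u},$$ where the local $\ell^2$ norm $\|\cdot\|_L$ is defined for $L \ge 1$ by $$\|u\|_L^2 = \sum_{n=1}^{[L]} |u(n)|^2 + (L-[L])\,|u([L]+1)|^2 .$$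
   Context: Let $\alpha = \frac{\sqrt{5}-1}{2}$. For $V>0$ and $\omega \in \mathbb{T} = \mathbb{R}/\mathbb{Z}$, the Fibonacci Hamiltonian is the bounded self-adjoint operator on $\ell^2(\mathbb{Z})$ given by $$[H_{V,\omega} \psi](n) = \psi(n+1) + \psi(n-1) + V \chi_{[1-\alpha,1)}(n\alpha + \omega \bmod 1)\, \psi(n).$$ Its spectrum does not depend on $\omega$; $\Sigma_V$ denotes the common spectrum, $\Sigma_V = \sigma(H_{V,\omega})$ for every $\omega \in \mathbb{T}$. $a_V$ denotes the largest root of the polynomial $x^3-(2+V)x-1$. Solutions of the difference equation $H_{V,\omega}u=Eu$ are functions $u$ on $\mathbb{Z}$ satisfying $u(n+1)+u(n-1)+V\chi_{[1-\alpha,1)}(n\alpha+\omega \bmod 1)u(n)=Eu(n)$ for all $n\in\mathbb{Z}$, not assumed square-summable. $[L]$ denotes the integer part of the real number $L$.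
   Formalization: The lower bound is proved for all L ≥ L₀ with L₀ > 1 arbitrary and C_ℓ depending on L₀, since at L = 1 it fails for u(0)=1, u(1)=0 (where ‖u‖_1 = 0) and no uniform constant works as L tends to 1; the upper bound holds for all L ≥ 1. *)

theory Defs
  imports "HOL-Analysis.Analysis"
begin

definition l2 :: "(int \<Rightarrow> complex) set" where
  "l2 = {\<psi>. (\<lambda>n. (norm (\<psi> n))\<^sup>2) summable_on UNIV}"

definition l2_norm :: "(int \<Rightarrow> complex) \<Rightarrow> real" where
  "l2_norm \<psi> = sqrt (\<Sum>\<^sub>\<infinity>n. (norm (\<psi> n))\<^sup>2)"

(* Operators are functions on all complex sequences; only their restriction to l2 matters. *)
definition bounded_op :: "((int \<Rightarrow> complex) \<Rightarrow> (int \<Rightarrow> complex)) \<Rightarrow> bool" where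
  "bounded_op T \<longleftrightarrow>
     (\<forall>\<psi>\<in>l2. T \<psi> \<in> l2) \<and>
     (\<forall>\<phi>\<in>l2. \<forall>\<psi>\<in>l2. T (\<lambda>n. \<phi> n + \<psi> n) = (\<lambda>n. T \<phi> n + T \<psi> n)) \<and>
     (\<forall>c. \<forall>\<psi>\<in>l2. T (\<lambda>n. c * \<psi> n) = (\<lambda>n. c * T \<psi> n)) \<and>
     (\<exists>K. \<forall>\<psi>\<in>l2. l2_norm (T \<psi>) \<le> K * l2_norm \<psi>)"

definition spectrum :: "((int \<Rightarrow> complex) \<Rightarrow> (int \<Rightarrow> complex)) \<Rightarrow> complex set" where
  "spectrum T = {z. \<not> (\<exists>R. bounded_op R \<and>
     (\<forall>\<psi>\<in>l2. R (\<lambda>n. T \<psi> n - z * \<psi> n) = \<psi> \<and>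
             (\<lambda>n. T (R \<psi>) n - z * R \<psi> n) = \<psi>))}"

definition fib_freq :: real where
  "fib_freq = (sqrt 5 - 1) / 2"

(* Points of the circle R/Z are represented by real numbers: the potential depends on \<omega>
   only modulo 1, so quantifying over all real \<omega> is quantifying over the circle. *)
definition fib_potential :: "real \<Rightarrow> real \<Rightarrow> int \<Rightarrow> real" where
  "fib_potential V \<omega> n =
     V * indicator {1 - fib_freq..<1} (frac (of_int n * fib_freq + \<omega>))"

(* Defined on all sequences, so that it also serves for the difference equation, whose
   solutions need not be square-summable. *)
definition fib_hamiltonian :: "real \<Rightarrow> real \<Rightarrow> (int \<Rightarrow> complex) \<Rightarrow> (int \<Rightarrow> complex)" where
  "fib_hamiltonian V \<omega> \<psi> =
     (\<lambda>n. \<psi> (n + 1) + \<psi> (n - 1) + of_real (fib_potential V \<omega> n) * \<psi> n)"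

(* The spectrum does not depend on \<omega>, so the union is the common spectrum.  It is a subset
   of the real line, although its elements have type complex here. *)
definition fib_spectrum :: "real \<Rightarrow> complex set" where
  "fib_spectrum V = (\<Union>\<omega>. spectrum (fib_hamiltonian V \<omega>))"

definition is_solution :: "real \<Rightarrow> real \<Rightarrow> complex \<Rightarrow> (int \<Rightarrow> complex) \<Rightarrow> bool" where
  "is_solution V \<omega> E u \<longleftrightarrow> (\<forall>n. fib_hamiltonian V \<omega> u n = E * u n)"

definition a_root :: "real \<Rightarrow> real" where
  "a_root V = Max {x. x ^ 3 - (2 + V) * x - 1 = 0}"

(* Only sites n >= 1 enter: for 1 <= L <= 2 one has
   (local_norm u L)^2 = |u 1|^2 + (L - 1) |u 2|^2.  For a solution with u 0 = 1 and u 1 = 0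
   this vanishes at L = 1 and tends to 0 as L decreases to 1, so lower bounds that are
   uniform over normalized solutions have to keep L away from 1. *)
definition local_norm :: "(int \<Rightarrow> complex) \<Rightarrow> real \<Rightarrow> real" where
  "local_norm u L = sqrt ((\<Sum>n = 1..\<lfloor>L\<rfloor>. (norm (u n))\<^sup>2) +
                          (L - of_int \<lfloor>L\<rfloor>) * (norm (u (\<lfloor>L\<rfloor> + 1)))\<^sup>2)"

end

theory Submission
  imports Defs "HOL-Number_Theory.Fib"
begin

text \<open>
  Write \<open>F\<^sub>k = fib k\<close> and \<open>\<alpha>\<close> for the frequency. Since \<open>F\<^sub>k \<alpha>\<close> is within \<open>\<alpha>\<^sup>k\<close> of an
  integer, the potential repeats with period \<open>F\<^sub>k\<close> as long as the orbit avoids a half-open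
  interval of length \<open>\<alpha>\<^sup>k\<close> next to a discontinuity. Over two such periods Cayley-Hamilton gives
  \<open>u (a + 2 F\<^sub>k) = t\<^sub>k u (a + F\<^sub>k) - u a\<close>, where \<open>t\<^sub>k\<close> is the \<open>k\<close>-th iterate of the trace map. The
  bad intervals of consecutive levels lie on opposite sides of the discontinuity, and the passage times
  between them are so long that, around every site and for every \<open>\<omega>\<close>, one of three (or four) consecutive
  levels is good. As \<open>\<bar>t\<^sub>k\<bar> \<le> 2 + V\<close> on the spectrum, the three-term relation bounds \<open>u\<close> far away by its
  values near the origin, which gives the upper estimate, and shows that the mass on \<open>[1, F\<^sub>k]\<close>
  is partially reproduced inside \<open>(F\<^sub>k, F\<^sub>k\<^sub>+\<^sub>6]\<close>, which gives the lower one.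

  For the trace bound, a spectral value \<open>z\<close> has finitely supported approximate eigenvectors, as
  otherwise a contraction argument would produce a bounded inverse of \<open>H - z\<close>. Putting such a vector on a ring of
  length \<open>F\<^sub>k\<close> yields a nearby eigenvalue of a symmetric matrix, at which \<open>t\<^sub>k = 2\<close>. Since two
  consecutive traces larger than \<open>2\<close> in modulus make all later ones larger than \<open>2\<close>, no two consecutive traces
  exceed \<open>2\<close> at \<open>z\<close>, and the invariant of the trace map bounds the rest by \<open>2 + V\<close>.
\<close>

section \<open>The golden rotation\<close>

lemma fib_freq_sq: "fib_freq * fib_freq = 1 - fib_freq"
proof -
  have "sqrt 5 * sqrt 5 = (5::real)" by simp
  then show ?thesis by (simp add: fib_freq_def field_simps)
qed

lemma fib_freq_bounds: "1 / 2 < fib_freq" "fib_freq < 1"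
proof -
  have "2 < sqrt (5::real)" by (rule real_less_rsqrt) simp
  moreover have "sqrt (5::real) < 3" by (rule real_less_lsqrt) simp_all
  ultimately show "1 / 2 < fib_freq" "fib_freq < 1" by (simp_all add: fib_freq_def)
qed

lemma fib_freq_power_Suc_Suc: "fib_freq ^ Suc (Suc n) = fib_freq ^ n - fib_freq ^ Suc n"
proof -
  have "fib_freq ^ Suc (Suc n) = (fib_freq * fib_freq) * fib_freq ^ n" by simp
  then show ?thesis unfolding fib_freq_sq by (simp add: algebra_simps)
qed

text \<open>By \<open>fib_freq_sq\<close>, -\<alpha> is a root of x^2 = x + 1, so its powers obey
  the Fibonacci recursion. The alternating sign of the error is the reason why consecutive levels
  sit on opposite sides of a discontinuity.\<close>

lemma fib_mult_freq: "of_nat (fib (Suc k)) * fib_freq = of_nat (fib k) - (- fib_freq) ^ Suc k"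
proof (induction k rule: fib.induct)
  case (3 n)
  have "(- fib_freq) ^ Suc (Suc (Suc n)) = (fib_freq * fib_freq) * (- fib_freq) ^ Suc n" by simp
  then have p: "(- fib_freq) ^ Suc (Suc (Suc n)) = (- fib_freq) ^ Suc n + (- fib_freq) ^ Suc (Suc n)"
    unfolding fib_freq_sq by (simp add: algebra_simps)
  have "of_nat (fib (Suc (Suc (Suc n)))) * fib_freq
      = of_nat (fib (Suc (Suc n))) * fib_freq + of_nat (fib (Suc n)) * fib_freq"
    by (simp add: algebra_simps)
  also have "\<dots> = of_nat (fib (Suc n)) + of_nat (fib n) - (- fib_freq) ^ Suc (Suc (Suc n))"
    unfolding 3 p by simp
  finally show ?case by simp
next
  case 2
  show ?case using fib_freq_sq by simp
qed simp

text \<open>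
  \<open>near k x\<close>: on the circle, \<open>x\<close> lies in the half-open interval of length \<open>\<alpha>\<^sup>k\<close> with endpoint
  \<open>0\<close>, to the right of \<open>0\<close> for odd \<open>k\<close> and to the left for even \<open>k\<close>; rotation by
  \<open>fib k\<close> steps moves \<open>0\<close> to the other endpoint of the closed interval.
\<close>

definition near :: "nat \<Rightarrow> real \<Rightarrow> bool" where
  "near k x \<longleftrightarrow> (\<exists>m::int. if odd k then 0 \<le> x - m \<and> x - m < fib_freq ^ k
                        else - (fib_freq ^ k) \<le> x - m \<and> x - m < 0)"

lemma near_add_int: "near k (x + of_int m) \<longleftrightarrow> near k x"
proof -
  have "near k x" if h: "near k (x + of_int m)" for x m
  proof -
    obtain l :: int where "if odd k then 0 \<le> x + of_int m - l \<and> x + of_int m - l < fib_freq ^ k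
                        else - (fib_freq ^ k) \<le> x + of_int m - l \<and> x + of_int m - l < 0"
      using h unfolding near_def by blast
    then show ?thesis unfolding near_def
      by (intro exI[of _ "l - m"]) (auto simp: algebra_simps split: if_splits)
  qed
  from this[of x m] this[of "x + of_int m" "- m"] show ?thesis by auto
qed

lemma near_rotate:
  assumes "1 \<le> k"
  shows "near l (x + of_nat (fib k) * fib_freq) \<longleftrightarrow> near l (x - (- fib_freq) ^ k)"
    and "near l (x - of_nat (fib k) * fib_freq) \<longleftrightarrow> near l (x + (- fib_freq) ^ k)"
proof -
  obtain k' where k: "k = Suc k'" using assms by (cases k) auto
  have *: "of_nat (fib k) * fib_freq = of_int (int (fib k')) - (- fib_freq) ^ k"
    using fib_mult_freq[of k'] k by simp
  show "near l (x + of_nat (fib k) * fib_freq) \<longleftrightarrow> near l (x - (- fib_freq) ^ k)"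
    using near_add_int[of l "x - (- fib_freq) ^ k" "int (fib k')"] unfolding * by (simp add: algebra_simps)
  show "near l (x - of_nat (fib k) * fib_freq) \<longleftrightarrow> near l (x + (- fib_freq) ^ k)"
    using near_add_int[of l "x + (- fib_freq) ^ k" "- int (fib k')"] unfolding * by (simp add: algebra_simps)
qed

lemma freq_power_pos: "0 < fib_freq ^ k"
  using fib_freq_bounds by simp

text \<open>For odd \<open>k\<close>, F_k steps carry [-\<alpha>^(k+1), 0) onto the right end of [0,
  \<alpha>^k); for even \<open>k\<close> the picture is reflected.\<close>

lemma near_Suc_rotate:
  assumes "1 \<le> k" "near (Suc k) x"
  shows "near k (x + of_nat (fib k) * fib_freq)"
  unfolding near_rotate(1)[OF assms(1)]
proof -
  obtain m :: int where m: "if odd (Suc k) then 0 \<le> x - m \<and> x - m < fib_freq ^ Suc k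
                        else - (fib_freq ^ Suc k) \<le> x - m \<and> x - m < 0"
    using assms unfolding near_def by blast
  have "fib_freq ^ Suc k < fib_freq ^ k" using freq_power_pos[of k] fib_freq_bounds by simp
  then show "near k (x - (- fib_freq) ^ k)"
    using m unfolding near_def
    by (intro exI[of _ m]) (auto simp: power_minus_odd split: if_splits simp del: power_Suc)
qed

lemma near_Suc_Suc: "near (Suc (Suc k)) x \<Longrightarrow> near k x"
  unfolding near_def fib_freq_power_Suc_Suc
  using freq_power_pos[of "Suc k"] by (auto simp del: power_Suc split: if_splits) force+

text \<open>\<alpha>^k = \<alpha>^(k+1) + \<alpha>^(k+2) cuts the level-k interval into the
  level-(k+2) interval, next to 0, and a translate of the level-(k+1) interval, which F_k backward
  steps return to its base.\<close>

lemma near_cases: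
  assumes "1 \<le> k" "near k x"
  obtains "near (Suc (Suc k)) x" | "near (Suc k) (x - of_nat (fib k) * fib_freq)"
proof (cases "near (Suc (Suc k)) x")
  case False
  obtain m :: int where m: "if odd k then 0 \<le> x - m \<and> x - m < fib_freq ^ k
                        else - (fib_freq ^ k) \<le> x - m \<and> x - m < 0"
    using assms unfolding near_def by blast
  have "\<not> (if odd k then 0 \<le> x - m \<and> x - m < fib_freq ^ Suc (Suc k)
                        else - (fib_freq ^ Suc (Suc k)) \<le> x - m \<and> x - m < 0)"
    using False unfolding near_def by simp
  with m have "near (Suc k) (x + (- fib_freq) ^ k)"
    unfolding near_def fib_freq_power_Suc_Suc
    by (intro exI[of _ m]) (auto simp: power_minus_odd split: if_splits simp del: power_Suc)
  then show ?thesis using that near_rotate(2)[OF assms(1)] by blast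
qed (use that in blast)

section \<open>Rokhlin towers of the rotation\<close>

lemma near_1_iff: "near 1 x \<longleftrightarrow> frac x < fib_freq"
proof
  assume "near 1 x"
  then obtain m :: int where m: "0 \<le> x - m" "x - m < fib_freq" by (auto simp: near_def)
  then have "\<lfloor>x\<rfloor> = m" using fib_freq_bounds by linarith
  with m show "frac x < fib_freq" by (simp add: frac_def)
next
  assume "frac x < fib_freq"
  then show "near 1 x" unfolding near_def by (intro exI[of _ "\<lfloor>x\<rfloor>"]) (auto simp: frac_def)
qed

lemma not_near_1_iff: "\<not> near 1 x \<longleftrightarrow> near 2 x"
proof -
  have sq: "fib_freq ^ 2 = 1 - fib_freq" using fib_freq_sq by (simp add: power2_eq_square)
  have "near 2 x \<longleftrightarrow> \<not> frac x < fib_freq"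
  proof
    assume "near 2 x"
    then obtain m :: int where m: "- (1 - fib_freq) \<le> x - m" "x - m < 0" unfolding near_def sq by auto
    then have "\<lfloor>x\<rfloor> = m - 1" using fib_freq_bounds by linarith
    with m show "\<not> frac x < fib_freq" by (simp add: frac_def)
  next
    assume "\<not> frac x < fib_freq"
    then show "near 2 x" unfolding near_def sq
      by (intro exI[of _ "\<lfloor>x\<rfloor> + 1"]) (use floor_correct[of x] in \<open>auto simp: frac_def\<close>)
  qed
  then show ?thesis unfolding near_1_iff by simp
qed

text \<open>Cutting and stacking: \<open>near_cases\<close> splits the base of the tower of height
  F_(k+1). One part is the level-(k+2) base, keeping that height; the other stands F_k steps above
  the level-(k+1) base, whose tower therefore grows to height F_(k+2).\<close>

lemma tower_cover:
  assumes "1 \<le> k"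
  shows "\<exists>m. (m < fib (Suc k) \<and> near k (x - of_nat m * fib_freq)) \<or>
             (m < fib k \<and> near (Suc k) (x - of_nat m * fib_freq))"
  using assms
proof (induction k rule: nat_induct_at_least)
  case base
  show ?case using not_near_1_iff[of x] by (intro exI[of _ 0]) (auto simp: numeral_2_eq_2)
next
  case (Suc k)
  from Suc.IH obtain m where "(m < fib (Suc k) \<and> near k (x - of_nat m * fib_freq)) \<or>
             (m < fib k \<and> near (Suc k) (x - of_nat m * fib_freq))" by blast
  then consider "m < fib (Suc k)" "near k (x - of_nat m * fib_freq)"
    | "m < fib k" "near (Suc k) (x - of_nat m * fib_freq)" by blast
  then show ?case
  proof cases
    case 1
    from near_cases[OF Suc.hyps 1(2)] show ?thesis
    proof cases
      case 1
      with \<open>m < fib (Suc k)\<close> show ?thesis by blast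
    next
      case 2
      then have "near (Suc k) (x - of_nat (m + fib k) * fib_freq)" by (simp add: algebra_simps)
      with \<open>m < fib (Suc k)\<close> show ?thesis by (intro exI[of _ "m + fib k"]) auto
    qed
  next
    case 2
    then show ?thesis by (intro exI[of _ m]) auto
  qed
qed

text \<open>The coding changes only if the displacement of length \<alpha>^k crosses an endpoint, 0
  or \<alpha>, of the coding interval; the point then lands in the level-k interval at that
  endpoint. For \<open>k\<close> at least 2 the displacement is no longer than either arc.\<close>

lemma near_1_rotate_neq:
  assumes "2 \<le> k" "near 1 x \<noteq> near 1 (x + of_nat (fib k) * fib_freq)"
  shows "near k (x + of_nat (fib k) * fib_freq) \<or> near k (x - fib_freq + of_nat (fib k) * fib_freq)"
proof -
  define a where "a = fib_freq ^ k"
  have k1: "1 \<le> k" using assms by simp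
  have a: "0 < a" "a \<le> 1 - fib_freq"
    using power_decreasing[OF assms(1), of fib_freq] fib_freq_bounds fib_freq_sq
    by (auto simp: a_def power2_eq_square)
  have sg: "(- fib_freq) ^ k = (if odd k then - a else a)" by (simp add: a_def)
  define f where "f = \<lfloor>x\<rfloor>"
  have f: "of_int f \<le> x" "x < of_int f + 1" unfolding f_def by linarith+
  have nx: "near 1 x \<longleftrightarrow> x - f < fib_freq" unfolding near_1_iff frac_def f_def by simp
  show ?thesis
  proof (cases "odd k")
    case True
    have d: "near 1 x \<noteq> near 1 (x + a)"
      using assms(2) unfolding near_rotate(1)[OF k1] sg using True by simp
    have "x + a - f < fib_freq \<longleftrightarrow> near 1 (x + a)" if "x + a < f + 1"
    proof -
      have "\<lfloor>x + a\<rfloor> = f" using that f a by linarith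
      then show ?thesis unfolding near_1_iff frac_def by simp
    qed
    then consider "x - f < fib_freq" "fib_freq \<le> x + a - f" | "f + 1 \<le> x + a"
      using d nx a by force
    then show ?thesis
    proof cases
      case 1
      then have "near k (x - fib_freq + a)" unfolding near_def
        using True f a by (intro exI[of _ f]) (auto simp: a_def)
      then show ?thesis unfolding near_rotate(1)[OF k1] sg using True by simp
    next
      case 2
      then have "near k (x + a)" unfolding near_def
        using True f a by (intro exI[of _ "f + 1"]) (auto simp: a_def)
      then show ?thesis unfolding near_rotate(1)[OF k1] sg using True by simp
    qed
  next
    case False
    have d: "near 1 x \<noteq> near 1 (x - a)"
      using assms(2) unfolding near_rotate(1)[OF k1] sg using False by simp
    have "x - a - f < fib_freq \<longleftrightarrow> near 1 (x - a)" if "f \<le> x - a"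
    proof -
      have "\<lfloor>x - a\<rfloor> = f" using that f a by linarith
      then show ?thesis unfolding near_1_iff frac_def by simp
    qed
    then consider "fib_freq \<le> x - f" "x - a - f < fib_freq" | "x - a < f"
      using d nx a by force
    then show ?thesis
    proof cases
      case 1
      then have "near k (x - fib_freq - a)" unfolding near_def
        using False f a by (intro exI[of _ f]) (auto simp: a_def)
      then show ?thesis unfolding near_rotate(1)[OF k1] sg using False by simp
    next
      case 2
      then have "near k (x - a)" unfolding near_def
        using False f a by (intro exI[of _ f]) (auto simp: a_def)
      then show ?thesis unfolding near_rotate(1)[OF k1] sg using False by simp
    qed
  qed
qed

section \<open>Displacements in a basis of Fibonacci pairs\<close>

lemma fib_unimodular:
  "\<exists>a b :: int. m = a * int (fib (Suc k)) + b * int (fib (Suc (Suc k))) \<and>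
                q = a * int (fib k) + b * int (fib (Suc k))"
proof (induction k arbitrary: m q)
  case 0
  show ?case by (intro exI[of _ "m - q"] exI[of _ q]) simp
next
  case (Suc k)
  obtain a b :: int where "q = a * int (fib (Suc k)) + b * int (fib (Suc (Suc k)))"
    "m - q = a * int (fib k) + b * int (fib (Suc k))"
    using Suc.IH[of q "m - q"] by blast
  then show ?case by (intro exI[of _ a] exI[of _ b]) (auto simp: algebra_simps)
qed

text \<open>Signs decide: b = 0 leaves only a = 1, b \<ge> 1 forces a \<ge> 1 by positivity, and b
  \<le> -1 forces a \<le> 0 by the upper bound.\<close>

lemma small_combination:
  fixes a b m :: int
  assumes "0 < a - b * fib_freq" "a - b * fib_freq < 1 + fib_freq"
    and m: "m = a * int (fib k) + b * int (fib (Suc k))"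
  shows "m = int (fib k) \<or> m \<ge> int (fib (Suc (Suc k))) \<or> m \<le> - int (fib (Suc k))"
proof -
  consider "b = 0" | "1 \<le> b" | "b \<le> -1" by linarith
  then show ?thesis
  proof cases
    case 1
    then have "0 < real_of_int a" "real_of_int a < 2" using assms fib_freq_bounds by simp_all
    then have "a = 1" by linarith
    with 1 m show ?thesis by simp
  next
    case 2
    then have "0 < b * fib_freq" using fib_freq_bounds by simp
    then have "0 < real_of_int a" using assms by linarith
    then have "1 \<le> a" by linarith
    then have "int (fib k) \<le> a * int (fib k)" "int (fib (Suc k)) \<le> b * int (fib (Suc k))"
      using 2 by (simp_all add: mult_le_cancel_right1)
    then show ?thesis using m by simp
  next
    case 3
    then have "b * fib_freq \<le> - 1 * fib_freq" using fib_freq_bounds by (intro mult_right_mono) auto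
    then have "real_of_int a < 1" using assms by linarith
    then have "a \<le> 0" by linarith
    then have "a * int (fib k) \<le> 0" by (simp add: mult_nonpos_nonneg)
    moreover have "b * int (fib (Suc k)) \<le> (-1) * int (fib (Suc k))"
      using 3 by (intro mult_right_mono) auto
    ultimately show ?thesis using m by simp
  qed
qed

text \<open>Writing \<open>(m, q)\<close> in the basis of consecutive Fibonacci pairs turns the displacement
  \<open>m \<alpha> - q\<close> into a multiple of \<open>a - b \<alpha>\<close>.\<close>

lemma displacement:
  fixes m q :: int
  assumes "1 \<le> k" "0 < (- ((- 1) ^ k)) * (m * fib_freq - q)"
    "(- ((- 1) ^ k)) * (m * fib_freq - q) < fib_freq ^ k + fib_freq ^ Suc k"
  shows "m = int (fib k) \<or> m \<ge> int (fib (Suc (Suc k))) \<or> m \<le> - int (fib (Suc k))"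
proof -
  obtain k' where k: "k = Suc k'" using assms by (cases k) auto
  obtain a b :: int where m: "m = a * int (fib (Suc k')) + b * int (fib (Suc (Suc k')))"
    and q: "q = a * int (fib k') + b * int (fib (Suc k'))"
    using fib_unimodular by blast
  have "m * fib_freq - q = a * (of_nat (fib (Suc k')) * fib_freq - of_nat (fib k'))
      + b * (of_nat (fib (Suc (Suc k'))) * fib_freq - of_nat (fib (Suc k')))"
    unfolding m q by (simp add: algebra_simps)
  also have "\<dots> = - ((a - b * fib_freq) * (- fib_freq) ^ k)"
    unfolding fib_mult_freq k by (simp add: algebra_simps)
  finally have E: "m * fib_freq - q = - ((a - b * fib_freq) * (- fib_freq) ^ k)" .
  have "(- ((- 1) ^ k)) * (m * fib_freq - q) = (a - b * fib_freq) * ((- 1) ^ k * (- fib_freq) ^ k)"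
    unfolding E by simp
  also have "(- 1) ^ k * (- fib_freq) ^ k = fib_freq ^ k" by (simp flip: power_mult_distrib)
  finally have eq: "(- ((- 1) ^ k)) * (m * fib_freq - q) = (a - b * fib_freq) * fib_freq ^ k" .
  have "0 < a - b * fib_freq"
    using assms(2) freq_power_pos[of k] unfolding eq by (simp only: zero_less_mult_iff) linarith
  moreover have "(a - b * fib_freq) * fib_freq ^ k < (1 + fib_freq) * fib_freq ^ k"
    using assms(3) unfolding eq by (simp add: algebra_simps)
  then have "a - b * fib_freq < 1 + fib_freq" using freq_power_pos[of k] by simp
  ultimately show ?thesis using small_combination m k by blast
qed

text \<open>The two points lie on opposite sides of 0, so their displacement has a known sign and is
  smaller than the sum of the two interval lengths, as \<open>displacement\<close> requires.\<close>

lemma near_separation: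
  assumes "1 \<le> k" "near (Suc k) x" "near k (x + of_int m * fib_freq)"
  shows "m = int (fib k) \<or> m \<ge> int (fib (Suc (Suc k))) \<or> m \<le> - int (fib (Suc k))"
proof -
  obtain p :: int where p: "if odd (Suc k) then 0 \<le> x - p \<and> x - p < fib_freq ^ Suc k
                        else - (fib_freq ^ Suc k) \<le> x - p \<and> x - p < 0"
    using assms unfolding near_def by blast
  obtain q :: int where q: "if odd k then 0 \<le> x + m * fib_freq - q \<and> x + m * fib_freq - q < fib_freq ^ k
                        else - (fib_freq ^ k) \<le> x + m * fib_freq - q \<and> x + m * fib_freq - q < 0"
    using assms unfolding near_def by blast
  show ?thesis
    by (rule displacement[OF assms(1), of m "q - p"])
      (use p q freq_power_pos[of k] freq_power_pos[of "Suc k"] in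
        \<open>auto simp del: power_Suc split: if_splits\<close>)
qed

text \<open>Undoing the rotation by F_k moves the level-k interval to the other side of 0, and
  likewise for level k+1. The argument of \<open>near_separation\<close> then applies with the two
  levels exchanged.\<close>

lemma near_separation_shifted:
  assumes "1 \<le> k" "near k (x + of_nat (fib k) * fib_freq)"
    "near (Suc k) (x + of_int m * fib_freq + of_nat (fib (Suc k)) * fib_freq)"
  shows "m = int (fib k) \<or> m \<ge> int (fib (Suc (Suc k))) \<or> m \<le> - int (fib (Suc k))"
proof -
  have "near k (x - (- fib_freq) ^ k)" "near (Suc k) (x + of_int m * fib_freq - (- fib_freq) ^ Suc k)"
    using assms near_rotate(1)[of k k x] near_rotate(1)[of "Suc k" "Suc k" "x + of_int m * fib_freq"] by auto
  then obtain p q :: int where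
    p: "if odd k then 0 \<le> x - (- fib_freq) ^ k - p \<and> x - (- fib_freq) ^ k - p < fib_freq ^ k
                        else - (fib_freq ^ k) \<le> x - (- fib_freq) ^ k - p \<and> x - (- fib_freq) ^ k - p < 0"
    and q: "if odd (Suc k) then 0 \<le> x + m * fib_freq - (- fib_freq) ^ Suc k - q \<and> x + m * fib_freq - (- fib_freq) ^ Suc k - q < fib_freq ^ Suc k
                        else - (fib_freq ^ Suc k) \<le> x + m * fib_freq - (- fib_freq) ^ Suc k - q \<and> x + m * fib_freq - (- fib_freq) ^ Suc k - q < 0"
    unfolding near_def by blast
  have s: "(- fib_freq) ^ k = (if odd k then - (fib_freq ^ k) else fib_freq ^ k)"
    "(- fib_freq) ^ Suc k = (if odd k then fib_freq ^ Suc k else - (fib_freq ^ Suc k))" by simp_all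
  show ?thesis
    by (rule displacement[OF assms(1), of m "q - p"])
      (use p q freq_power_pos[of k] freq_power_pos[of "Suc k"] in
        \<open>auto simp del: power_Suc simp: s split: if_splits\<close>)
qed

section \<open>Transfer matrices and the trace map\<close>

definition step_matrix :: "real \<Rightarrow> real^2^2" where
  "step_matrix c = vector [vector [c, -1], vector [1, 0]]"

primrec transfer :: "(int \<Rightarrow> real) \<Rightarrow> int \<Rightarrow> nat \<Rightarrow> real^2^2" where
  "transfer c i 0 = mat 1"
| "transfer c i (Suc m) = step_matrix (c (i + int m)) ** transfer c i m"

lemma transfer_add: "transfer c i (m + n) = transfer c (i + int m) n ** transfer c i m"
  by (induction n) (simp_all add: matrix_mul_assoc add.assoc)

lemma transfer_cong:
  assumes "\<And>j. j < m \<Longrightarrow> c (i + int j) = c' (i' + int j)"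
  shows "transfer c i m = transfer c' i' m"
  using assms by (induction m) simp_all

lemma det_step_matrix: "det (step_matrix c) = 1"
  by (simp add: step_matrix_def det_2)

lemma det_transfer: "det (transfer c i m) = 1"
  by (induction m) (simp_all add: det_mul det_step_matrix)

lemma step_matrix_mult_vec: "step_matrix c *v vector [x, y] = vector [c * x - y, x]"
  by (simp add: step_matrix_def vec_eq_iff forall_2 matrix_vector_mult_def sum_2)

lemma transfer_solution:
  assumes "\<And>n. w (n + 1) + w (n - 1) = c n * w n"
  shows "transfer c i m *v vector [w i, w (i - 1)] = vector [w (i + int m), w (i + int m - 1)]"
proof (induction m)
  case (Suc m)
  have "c (i + int m) * w (i + int m) - w (i + int m - 1) = w (i + int m + 1)"
    using assms[of "i + int m"] by simp
  moreover have "i + int (Suc m) = i + int m + 1" by simp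
  ultimately show ?case
    by (simp only: transfer.simps matrix_vector_mul_assoc[symmetric] Suc step_matrix_mult_vec) simp
qed simp

section \<open>The trace map of the Fibonacci matrices\<close>

lemma Cayley_Hamilton_2:
  fixes A :: "real^2^2"
  shows "A ** A = trace A *\<^sub>R A - det A *\<^sub>R mat 1"
  by (simp add: vec_eq_iff forall_2 matrix_matrix_mult_def sum_2 trace_def det_2 mat_def algebra_simps)

text \<open>The matrix of index \<open>0\<close> is chosen such that the recursion gives \<open>step_matrix (E - V)\<close> at index \<open>2\<close>.\<close>

fun fib_matrix :: "real \<Rightarrow> real \<Rightarrow> nat \<Rightarrow> real^2^2" where
  "fib_matrix E V 0 = vector [vector [1, 0], vector [V, 1]]"
| "fib_matrix E V (Suc 0) = step_matrix E"
| "fib_matrix E V (Suc (Suc k)) = fib_matrix E V (Suc k) ** fib_matrix E V k"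

definition fib_trace :: "real \<Rightarrow> real \<Rightarrow> nat \<Rightarrow> real" where
  "fib_trace E V k = trace (fib_matrix E V k)"

lemma det_fib_matrix: "det (fib_matrix E V k) = 1"
  by (induction k rule: fib.induct) (simp_all add: det_mul det_step_matrix, simp add: det_2)

lemma fib_matrix_2: "fib_matrix E V 2 = step_matrix (E - V)"
  by (simp add: numeral_2_eq_2 step_matrix_def vec_eq_iff forall_2 matrix_matrix_mult_def sum_2)

lemma fib_trace_initial: "fib_trace E V 0 = 2" "fib_trace E V 1 = E" "fib_trace E V 2 = E - V"
  unfolding fib_trace_def fib_matrix_2 by (simp_all add: trace_def sum_2 step_matrix_def)

lemma trace_scaleR: "trace (c *\<^sub>R A) = c * trace (A :: real^'n^'n)"
  by (simp add: trace_def sum_distrib_left)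

text \<open>M_(k+3) = A B A with A = M_(k+1), B = M_k has the trace of A^2 B, and Cayley-Hamilton
  with det A = 1 reduces A^2.\<close>

lemma fib_trace_rec:
  "fib_trace E V (Suc (Suc (Suc k))) = fib_trace E V (Suc (Suc k)) * fib_trace E V (Suc k) - fib_trace E V k"
proof -
  define A where "A = fib_matrix E V (Suc k)"
  define B where "B = fib_matrix E V k"
  have dA: "det A = 1" by (simp add: A_def det_fib_matrix)
  have "fib_trace E V (Suc (Suc (Suc k))) = trace (A ** (B ** A))"
    by (simp add: fib_trace_def A_def B_def matrix_mul_assoc)
  also have "\<dots> = trace ((A ** A) ** B)"
    by (metis matrix_mul_assoc trace_mul_sym)
  also have "(A ** A) ** B = trace A *\<^sub>R (A ** B) - B"
    unfolding Cayley_Hamilton_2[of A] dA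
    by (simp add: vec_eq_iff forall_2 matrix_matrix_mult_def sum_2 mat_def algebra_simps)
  finally show ?thesis
    by (simp add: fib_trace_def A_def B_def trace_sub trace_scaleR)
qed

text \<open>The Fricke-Vogt invariant. The left side is quadratic in the oldest trace, and the
  recursion replaces that trace by the other root, so the value is conserved.\<close>

lemma fib_trace_invariant:
  "(fib_trace E V (Suc (Suc k)))\<^sup>2 + (fib_trace E V (Suc k))\<^sup>2 + (fib_trace E V k)\<^sup>2
     - fib_trace E V (Suc (Suc k)) * fib_trace E V (Suc k) * fib_trace E V k - 4 = V\<^sup>2"
proof (induction k)
  case 0
  have t: "fib_trace E V (Suc 0) = E" "fib_trace E V (Suc (Suc 0)) = E - V"
    using fib_trace_initial(2,3)[of E V] unfolding numeral_2_eq_2 One_nat_def .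
  show ?case unfolding t fib_trace_initial(1) by (simp add: power2_eq_square algebra_simps)
next
  case (Suc k)
  show ?case unfolding fib_trace_rec using Suc by (simp add: power2_eq_square algebra_simps)
qed

text \<open>Besides the two lower bounds, the induction carries |t_j| < |t_(j+2)|. It yields
  |t_(j+3)| > |t_(j+2)| (|t_(j+1)| - 1), which exceeds |t_(j+1)| because both factors come from
  traces above 2.\<close>

lemma fib_trace_escape:
  assumes "\<bar>fib_trace E V k\<bar> \<le> 2" "2 < \<bar>fib_trace E V (Suc k)\<bar>" "2 < \<bar>fib_trace E V (Suc (Suc k))\<bar>"
  shows "2 < \<bar>fib_trace E V (Suc k + j)\<bar>"
proof -
  let ?t = "\<lambda>j. \<bar>fib_trace E V (k + j)\<bar>"
  have "2 < ?t (Suc j) \<and> 2 < ?t (Suc (Suc j)) \<and> ?t j < ?t (Suc (Suc j))" for j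
  proof (induction j)
    case (Suc j)
    have "\<bar>x * y - z\<bar> \<ge> \<bar>x\<bar> * \<bar>y\<bar> - \<bar>z\<bar>" for x y z :: real
      by (metis abs_mult abs_triangle_ineq2)
    from this[of "fib_trace E V (Suc (Suc (k + j)))" "fib_trace E V (Suc (k + j))" "fib_trace E V (k + j)"]
    have r: "?t (Suc (Suc (Suc j))) \<ge> ?t (Suc (Suc j)) * ?t (Suc j) - ?t j"
      using fib_trace_rec[of E V "k + j"] by simp
    have p: "0 < (?t (Suc (Suc j)) - 2) * (?t (Suc j) - 2)" using Suc by (intro mult_pos_pos) auto
    have "?t (Suc (Suc (Suc j))) > ?t (Suc (Suc j)) * (?t (Suc j) - 1)"
      using r Suc by (simp add: algebra_simps)
    moreover have "?t (Suc (Suc j)) * (?t (Suc j) - 1) > ?t (Suc j)"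
      using p Suc by (simp add: algebra_simps)
    ultimately show ?case using Suc by simp
  qed (use assms in auto)
  from this[of j] show ?thesis by simp
qed

text \<open>Going back from \<open>n\<close>, one meets a trace of modulus at most 2, at the latest
  t_0 = 2, and \<open>fib_trace_escape\<close> starts there.\<close>

lemma fib_trace_escape':
  assumes "2 < \<bar>fib_trace E V n\<bar>" "2 < \<bar>fib_trace E V (Suc n)\<bar>" "n \<le> m"
  shows "2 < \<bar>fib_trace E V m\<bar>"
  using assms
proof (induction n)
  case 0
  then show ?case by (simp add: fib_trace_initial)
next
  case (Suc n)
  show ?case
  proof (cases "2 < \<bar>fib_trace E V n\<bar>")
    case True
    with Suc show ?thesis by simp
  next
    case False
    obtain j where "m = Suc n + j" using Suc.prems(3) le_Suc_ex by blast
    then show ?thesis using fib_trace_escape[of E V n j] Suc.prems False by simp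
  qed
qed

text \<open>The invariant is a quadratic equation for a trace \<open>x\<close> in terms of its two neighbours.\<close>

lemma invariant_bound:
  fixes x y z V :: real
  assumes "x\<^sup>2 + y\<^sup>2 + z\<^sup>2 - x * y * z - 4 = V\<^sup>2" "\<bar>y\<bar> \<le> 2" "\<bar>z\<bar> \<le> 2" "0 \<le> V"
  shows "\<bar>x\<bar> \<le> 2 + V"
proof -
  have yz: "y\<^sup>2 \<le> 4" "z\<^sup>2 \<le> 4" using assms(2,3) by (simp_all add: abs_le_square_iff[of _ 2, simplified])
  \<comment> \<open>Completing the square. The estimate 2|yz| \<le> y^2 + z^2 then bounds the
    product by (2 - |yz|/2)^2, so that the terms |yz|/2 cancel at the end.\<close>
  have "(x - y * z / 2)\<^sup>2 = V\<^sup>2 + (4 - y\<^sup>2) * (4 - z\<^sup>2) / 4"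
    using assms(1) by (simp add: power2_eq_square field_simps)
  also have "(4 - y\<^sup>2) * (4 - z\<^sup>2) / 4 \<le> (2 - \<bar>y * z\<bar> / 2)\<^sup>2"
  proof -
    have "0 \<le> (\<bar>y\<bar> - \<bar>z\<bar>)\<^sup>2" by simp
    then have "2 * \<bar>y * z\<bar> \<le> y\<^sup>2 + z\<^sup>2" by (simp add: power2_diff abs_mult)
    moreover have "\<bar>y * z\<bar>\<^sup>2 = y\<^sup>2 * z\<^sup>2" by (simp add: power_mult_distrib)
    moreover have "(4 - y\<^sup>2) * (4 - z\<^sup>2) / 4 = 4 - (y\<^sup>2 + z\<^sup>2) + y\<^sup>2 * z\<^sup>2 / 4"
      by (simp add: field_simps)
    moreover have "(2 - \<bar>y * z\<bar> / 2)\<^sup>2 = 4 - 2 * \<bar>y * z\<bar> + \<bar>y * z\<bar>\<^sup>2 / 4"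
      by (simp add: power2_diff power_divide)
    ultimately show ?thesis by linarith
  qed
  also have "V\<^sup>2 + (2 - \<bar>y * z\<bar> / 2)\<^sup>2 \<le> (V + (2 - \<bar>y * z\<bar> / 2))\<^sup>2"
  proof -
    have "\<bar>y\<bar> * \<bar>z\<bar> \<le> 2 * 2" using assms by (intro mult_mono) auto
    then have "0 \<le> V * (2 - \<bar>y * z\<bar> / 2)" using assms by (simp add: abs_mult)
    then show ?thesis by (simp add: power2_sum)
  qed
  finally have "\<bar>x - y * z / 2\<bar> \<le> \<bar>V + (2 - \<bar>y * z\<bar> / 2)\<bar>" by (simp add: abs_le_square_iff)
  moreover have "\<bar>y * z\<bar> \<le> 2 * 2" unfolding abs_mult using assms by (intro mult_mono) auto
  moreover have "\<bar>x\<bar> \<le> \<bar>x - y * z / 2\<bar> + \<bar>y * z\<bar> / 2"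
    using abs_triangle_ineq[of "x - y * z / 2" "y * z / 2"] by simp
  ultimately show ?thesis using assms(4) by linarith
qed

text \<open>A trace exceeding 2 in modulus has an index above 0, since t_0 = 2, and both of its
  neighbours are bounded by 2.\<close>

lemma fib_trace_bound:
  assumes "0 \<le> V" and dich: "\<And>n. \<bar>fib_trace E V n\<bar> \<le> 2 \<or> \<bar>fib_trace E V (Suc n)\<bar> \<le> 2"
  shows "\<bar>fib_trace E V k\<bar> \<le> 2 + V"
proof (cases "\<bar>fib_trace E V k\<bar> \<le> 2")
  case False
  then obtain j where k: "k = Suc j" by (cases k) (auto simp: fib_trace_initial)
  have "\<bar>fib_trace E V j\<bar> \<le> 2" "\<bar>fib_trace E V (Suc (Suc j))\<bar> \<le> 2"
    using dich[of j] dich[of k] False k by auto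
  then show ?thesis using fib_trace_invariant[of E V j] assms(1) unfolding k
    by (intro invariant_bound[of _ "fib_trace E V (Suc (Suc j))" "fib_trace E V j"]) (auto simp: algebra_simps)
qed (use assms in auto)

section \<open>Local periodicity of the potential\<close>

text \<open>The extra rotation by \<alpha> carries the coding interval [1 - \<alpha>, 1) to [0,
  \<alpha>) modulo 1, which is \<open>near 1\<close>.\<close>

definition site :: "real \<Rightarrow> int \<Rightarrow> real" where
  "site \<omega> n = \<omega> + (of_int n + 1) * fib_freq"

lemma site_add: "site \<omega> (n + m) = site \<omega> n + of_int m * fib_freq"
  and site_diff: "site \<omega> (n - m) = site \<omega> n - of_int m * fib_freq"
  by (simp_all add: site_def algebra_simps)

lemma fib_potential_eq: "fib_potential V \<omega> n = (if near 1 (site \<omega> n) then V else 0)"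
proof -
  define x where "x = of_int n * fib_freq + \<omega>"
  have x: "site \<omega> n = x + fib_freq" by (simp add: site_def x_def algebra_simps)
  have f: "0 \<le> frac x" "frac x < 1" by (simp_all add: frac_lt_1)
  have "frac (x + fib_freq) = (if frac x + fib_freq < 1 then frac x + fib_freq else frac x + fib_freq - 1)"
    using frac_add[of x fib_freq] frac_eq[of fib_freq] fib_freq_bounds by simp
  moreover have "\<dots> < fib_freq \<longleftrightarrow> 1 - fib_freq \<le> frac x"
    using f by (cases "frac x + fib_freq < 1") (simp_all only: if_True if_False, linarith+)
  ultimately have "near 1 (site \<omega> n) \<longleftrightarrow> 1 - fib_freq \<le> frac x"
    unfolding near_1_iff x by simp
  then show ?thesis using f by (simp add: fib_potential_def x_def[symmetric] indicator_def)
qed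

text \<open>A path from the level-(k+1) base first runs through F_k sites, is then in the level-k
  base by \<open>near_Suc_rotate\<close>, and continues for F_(k+1) sites. This is the factorization
  M_(k+2) = M_(k+1) M_k.\<close>

lemma transfer_block:
  fixes E V \<omega> :: real
  defines "c \<equiv> \<lambda>n. E - fib_potential V \<omega> n"
  assumes "1 \<le> k"
  shows "(near k (site \<omega> i) \<longrightarrow> transfer c i (fib (Suc k)) = fib_matrix E V (Suc k)) \<and>
         (near (Suc k) (site \<omega> i) \<longrightarrow> transfer c i (fib k) = fib_matrix E V k)"
  using assms(2)
proof (induction k arbitrary: i rule: nat_induct_at_least)
  case base
  show ?case using not_near_1_iff[of "site \<omega> i"] fib_matrix_2[of E V]
    by (auto simp: c_def fib_potential_eq numeral_2_eq_2)
next
  case (Suc k)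
  have "transfer c i (fib (Suc (Suc k))) = fib_matrix E V (Suc (Suc k))" if n: "near (Suc k) (site \<omega> i)"
  proof -
    have "near k (site \<omega> (i + int (fib k)))"
      using near_Suc_rotate[OF Suc.hyps n] by (simp add: site_add)
    then show ?thesis using Suc.IH n
      by (simp add: transfer_add[of c i "fib k" "fib (Suc k)"] add.commute[of "fib (Suc k)"])
  qed
  then show ?case using Suc.IH[of i] near_Suc_Suc[of k "site \<omega> i"] by blast
qed

text \<open>From the level-(k+1) base the path reads F_k and then F_(k-1) sites, giving M_(k-1) M_k
  instead of M_k M_(k-1); the trace is the same.\<close>

lemma trace_transfer_block:
  assumes "2 \<le> k" "near k (site \<omega> i) \<or> near (Suc k) (site \<omega> i)"
  shows "trace (transfer (\<lambda>n. E - fib_potential V \<omega> n) i (fib (Suc k))) = fib_trace E V (Suc k)"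
proof -
  let ?c = "\<lambda>n. E - fib_potential V \<omega> n"
  obtain j where k: "k = Suc j" "1 \<le> j" using assms(1) by (cases k) auto
  from assms(2) show ?thesis
  proof
    assume "near k (site \<omega> i)"
    then show ?thesis using transfer_block[of k \<omega> i E V] assms(1) by (simp add: fib_trace_def del: fib.simps)
  next
    assume n: "near (Suc k) (site \<omega> i)"
    then have A: "transfer ?c i (fib k) = fib_matrix E V k"
      using transfer_block[of k \<omega> i E V] assms(1) by simp
    have "near k (site \<omega> (i + int (fib k)))"
      using near_Suc_rotate[of k] n assms(1) by (simp add: site_add)
    then have "transfer ?c (i + int (fib k)) (fib j) = fib_matrix E V j"
      using transfer_block[of j \<omega> "i + int (fib k)" E V] k by simp
    with A have "transfer ?c i (fib (Suc k)) = fib_matrix E V j ** fib_matrix E V k"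
      using transfer_add[of ?c i "fib k" "fib j"] k by simp
    then show ?thesis using k trace_mul_sym[of "fib_matrix E V j" "fib_matrix E V k"]
      by (simp add: fib_trace_def)
  qed
qed

text \<open>\<open>mismatch \<omega> k i\<close>: the potential is not \<open>fib k\<close>-periodic across the sites
  \<open>i\<close> and \<open>i + 1\<close>.\<close>

definition mismatch :: "real \<Rightarrow> nat \<Rightarrow> int \<Rightarrow> bool" where
  "mismatch \<omega> k i \<longleftrightarrow> near k (site \<omega> (i + int (fib k)))"

text \<open>The coding endpoints 0 and \<alpha> are one rotation step apart, so crossing \<alpha> at
  site \<open>i\<close> is a mismatch at \<open>i - 1\<close>.\<close>

lemma fib_potential_periodic:
  assumes "2 \<le> k" "\<not> mismatch \<omega> k i" "\<not> mismatch \<omega> k (i - 1)"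
  shows "fib_potential V \<omega> (i + int (fib k)) = fib_potential V \<omega> i"
proof -
  have "near 1 (site \<omega> i) = near 1 (site \<omega> i + of_nat (fib k) * fib_freq)"
    using near_1_rotate_neq[OF assms(1), of "site \<omega> i"] assms(2,3) site_diff[of \<omega> i 1]
    by (auto simp: mismatch_def site_add)
  then show ?thesis by (simp add: fib_potential_eq site_add)
qed

context
  fixes E V \<omega> :: real and k :: nat and a :: int
  assumes k: "3 \<le> k" and ok: "\<And>i. a \<le> i \<Longrightarrow> i < a + int (fib k) \<Longrightarrow> \<not> mismatch \<omega> k i"
begin

text \<open>By \<open>tower_cover\<close> the window contains a site \<open>?i\<close> in the base
  of a tower. The period read from \<open>?i\<close> is a cyclic rotation of the window, because the
  first \<open>d\<close> sites repeat one period later.\<close>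

lemma trace_transfer_period:
  "trace (transfer (\<lambda>n. E - fib_potential V \<omega> n) (a + 1) (fib k)) = fib_trace E V k"
proof -
  let ?c = "\<lambda>n. E - fib_potential V \<omega> n"
  obtain j where j: "k = Suc j" "2 \<le> j" using k by (cases k) auto
  let ?x = "site \<omega> (a + int (fib k))"
  obtain m where m: "(m < fib k \<and> near j (?x - of_nat m * fib_freq)) \<or>
             (m < fib j \<and> near k (?x - of_nat m * fib_freq))"
    using tower_cover[of j ?x] j by auto
  have mk: "m < fib k" using m fib_mono[of j k] j by auto
  define d where "d = fib k - Suc m"
  let ?i = "a + 1 + int d"
  have i: "?i = a + int (fib k) - int m" using mk by (simp add: d_def of_nat_diff)
  have "near j (site \<omega> ?i) \<or> near (Suc j) (site \<omega> ?i)"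
    unfolding i using m j by (auto simp: site_diff)
  then have t: "trace (transfer ?c ?i (fib k)) = fib_trace E V k"
    using trace_transfer_block[of j] j by simp
  have dk: "fib k = d + Suc m" using mk by (simp add: d_def)
  have e: "transfer ?c (?i + int (Suc m)) d = transfer ?c (a + 1) d"
  proof (rule transfer_cong)
    fix l assume "l < d"
    then have "fib_potential V \<omega> (a + 1 + int l + int (fib k)) = fib_potential V \<omega> (a + 1 + int l)"
      using k dk by (intro fib_potential_periodic ok) auto
    then show "E - fib_potential V \<omega> (?i + int (Suc m) + int l) = E - fib_potential V \<omega> (a + 1 + int l)"
      by (simp add: dk algebra_simps)
  qed
  have "transfer ?c (a + 1) (fib k) = transfer ?c ?i (Suc m) ** transfer ?c (a + 1) d"
    unfolding dk by (rule transfer_add)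
  moreover have "transfer ?c ?i (fib k) = transfer ?c (a + 1) d ** transfer ?c ?i (Suc m)"
    unfolding dk add.commute[of d] transfer_add e ..
  ultimately show ?thesis using t trace_mul_sym by metis
qed

lemma three_term:
  assumes "\<And>n. w (n + 1) + w (n - 1) = (E - fib_potential V \<omega> n) * w n"
  shows "w (a + 2 * int (fib k)) = fib_trace E V k * w (a + int (fib k)) - w a"
proof -
  let ?c = "\<lambda>n. E - fib_potential V \<omega> n"
  \<comment> \<open>Only the F_k - 1 sites a + 1, ..., a + F_k - 1 are known to repeat. The steps at
    a + F_k and a + 2 F_k may differ, but every step matrix copies the first entry into the second
    one, so the second entry is still \<open>w (a + 2 * int (fib k))\<close>.\<close>
  define p where "p = fib k - 1"
  have p: "fib k = Suc p" using fib_neq_0_nat[of k] k by (simp add: p_def)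
  let ?W = "transfer ?c (a + 1) p"
  let ?A = "transfer ?c (a + 1) (fib k)"
  let ?U = "\<lambda>n. vector [w (n + 1), w n] :: real^2"
  note sol = transfer_solution[of w ?c, OF assms]
  have U: "transfer ?c (n + 1) m *v ?U n = ?U (n + int m)" for n m
    using sol[of "n + 1" m] by (simp add: algebra_simps)
  have W: "transfer ?c (a + int (fib k) + 1) p = ?W"
  proof (rule transfer_cong)
    fix l assume "l < p"
    then have "fib_potential V \<omega> (a + 1 + int l + int (fib k)) = fib_potential V \<omega> (a + 1 + int l)"
      using k p by (intro fib_potential_periodic ok) auto
    then show "?c (a + int (fib k) + 1 + int l) = ?c (a + 1 + int l)"
      by (simp add: algebra_simps)
  qed
  have A: "?A = step_matrix (?c (a + 1 + int p)) ** ?W" unfolding p by simp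
  have 1: "?A *v ?U a = ?U (a + int (fib k))" by (rule U)
  have "?A *v (?A *v ?U a) = step_matrix (?c (a + 1 + int p)) *v (?W *v ?U (a + int (fib k)))"
    unfolding 1 unfolding A by (simp flip: matrix_vector_mul_assoc)
  also have "?W *v ?U (a + int (fib k)) = ?U (a + int (fib k) + int p)"
    using U[of "a + int (fib k)" p] unfolding W .
  finally have "(?A *v (?A *v ?U a)) $ 2 = w (a + 2 * int (fib k))"
    by (simp add: step_matrix_mult_vec p algebra_simps)
  moreover have "?A *v (?A *v ?U a) = fib_trace E V k *\<^sub>R (?A *v ?U a) - ?U a"
  proof -
    have "?A *v (?A *v ?U a) = (?A ** ?A) *v ?U a" by (simp add: matrix_vector_mul_assoc)
    also have "?A ** ?A = fib_trace E V k *\<^sub>R ?A - mat 1"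
      by (simp add: Cayley_Hamilton_2[of ?A] trace_transfer_period det_transfer)
    finally show ?thesis
      by (simp add: matrix_vector_mult_diff_rdistrib scaleR_matrix_vector_assoc)
  qed
  ultimately show ?thesis unfolding 1 by simp
qed

end

section \<open>Growth of solutions\<close>

lemma mismatch_gap:
  assumes "1 \<le> j" "mismatch \<omega> j i" "mismatch \<omega> (Suc j) i'"
  shows "i' - i = int (fib j) \<or> i' - i \<ge> int (fib (Suc (Suc j))) \<or> i' - i \<le> - int (fib (Suc j))"
proof (rule near_separation_shifted[OF assms(1)])
  show "near j (site \<omega> i + of_nat (fib j) * fib_freq)"
    using assms(2) by (simp add: mismatch_def site_add)
  have "site \<omega> i' = site \<omega> i + of_int (i' - i) * fib_freq" by (simp add: site_def algebra_simps)
  then show "near (Suc j) (site \<omega> i + of_int (i' - i) * fib_freq + of_nat (fib (Suc j)) * fib_freq)"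
    using assms(3) unfolding mismatch_def site_add by (metis of_int_of_nat_eq)
qed

lemma mismatch_gap_end:
  assumes "1 \<le> j" "mismatch \<omega> j i" "mismatch \<omega> (Suc j) i'"
  defines "m \<equiv> (i + int (fib j)) - (i' + int (fib (Suc j)))"
  shows "m = int (fib j) \<or> m \<ge> int (fib (Suc (Suc j))) \<or> m \<le> - int (fib (Suc j))"
proof (rule near_separation[OF assms(1)])
  show "near (Suc j) (site \<omega> (i' + int (fib (Suc j))))"
    using assms(3) unfolding mismatch_def .
  show "near j (site \<omega> (i' + int (fib (Suc j))) + of_int m * fib_freq)"
    using assms(2) unfolding mismatch_def m_def site_add[symmetric] by simp
qed

text \<open>If all three levels failed, the windows would be too short for the two large
  alternatives of \<open>mismatch_gap\<close>. The gaps would be exactly F_k and F_(k+1), putting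
  the third mismatch at least F_(k+2) to the right of \<open>s\<close>, outside its window.\<close>

lemma no_mismatch_right:
  assumes "1 \<le> k"
  obtains j where "k \<le> j" "j \<le> k + 2" "\<And>i. s \<le> i \<Longrightarrow> i < s + int (fib j) \<Longrightarrow> \<not> mismatch \<omega> j i"
proof (rule ccontr)
  assume "\<not> thesis"
  with that have "\<exists>i. s \<le> i \<and> i < s + int (fib j) \<and> mismatch \<omega> j i" if "k \<le> j" "j \<le> k + 2" for j
    using that by blast
  from this[of k] this[of "Suc k"] this[of "Suc (Suc k)"]
  obtain i0 i1 i2 where i: "s \<le> i0" "i0 < s + int (fib k)" "mismatch \<omega> k i0"
    "s \<le> i1" "i1 < s + int (fib (Suc k))" "mismatch \<omega> (Suc k) i1"
    "s \<le> i2" "i2 < s + int (fib (Suc (Suc k)))" "mismatch \<omega> (Suc (Suc k)) i2" by force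
  have "i1 - i0 = int (fib k)"
    using mismatch_gap[OF assms(1) i(3) i(6)] i fib_Suc_mono[of k] by auto
  moreover have "i2 - i1 = int (fib (Suc k))"
    using mismatch_gap[OF _ i(6) i(9)] i fib_Suc_mono[of k] by auto
  ultimately show False using i by simp
qed

text \<open>Mirror image of \<open>no_mismatch_right\<close>: the partner sites i + F_j lie in [n -
  F_j, n) and would move to the left by F_k and F_(k+1).\<close>

lemma no_mismatch_left:
  assumes "1 \<le> k"
  obtains j where "k \<le> j" "j \<le> k + 2"
    "\<And>i. n - 2 * int (fib j) \<le> i \<Longrightarrow> i < n - int (fib j) \<Longrightarrow> \<not> mismatch \<omega> j i"
proof (rule ccontr)
  assume "\<not> thesis"
  with that have "\<exists>i. n - 2 * int (fib j) \<le> i \<and> i < n - int (fib j) \<and> mismatch \<omega> j i"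
    if "k \<le> j" "j \<le> k + 2" for j using that by blast
  from this[of k] this[of "Suc k"] this[of "Suc (Suc k)"]
  obtain i0 i1 i2 where i: "n - 2 * int (fib k) \<le> i0" "i0 < n - int (fib k)" "mismatch \<omega> k i0"
    "n - 2 * int (fib (Suc k)) \<le> i1" "i1 < n - int (fib (Suc k))" "mismatch \<omega> (Suc k) i1"
    "n - 2 * int (fib (Suc (Suc k))) \<le> i2" "i2 < n - int (fib (Suc (Suc k)))" "mismatch \<omega> (Suc (Suc k)) i2"
    by force
  have "(i0 + int (fib k)) - (i1 + int (fib (Suc k))) = int (fib k)"
    using mismatch_gap_end[OF assms(1) i(3) i(6)] i fib_Suc_mono[of k] by auto
  moreover have "(i1 + int (fib (Suc k))) - (i2 + int (fib (Suc (Suc k)))) = int (fib (Suc k))"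
    using mismatch_gap_end[OF _ i(6) i(9)] i fib_Suc_mono[of k] by auto
  ultimately show False using i by simp
qed

text \<open>The extra F_k - 1 sites let the three-term relation start anywhere in a block of length
  F_k, as \<open>mass_growth\<close> needs. A fourth level pays for them: the three forced gaps add
  up to F_(k+4) + F_(k+1), beyond the last window.\<close>

lemma no_mismatch_long:
  assumes "1 \<le> k"
  obtains j where "Suc k \<le> j" "j \<le> k + 4"
    "\<And>i. s \<le> i \<Longrightarrow> i < s + int (fib j) + int (fib k) - 1 \<Longrightarrow> \<not> mismatch \<omega> j i"
proof (rule ccontr)
  assume "\<not> thesis"
  with that have ex: "\<exists>i. s \<le> i \<and> i < s + int (fib j) + int (fib k) - 1 \<and> mismatch \<omega> j i"
    if "Suc k \<le> j" "j \<le> k + 4" for j using that by blast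
  define k1 where "k1 = Suc k"
  define k2 where "k2 = Suc k1"
  define k3 where "k3 = Suc k2"
  have le: "Suc k \<le> k1" "k1 \<le> k + 4" "Suc k \<le> k2" "k2 \<le> k + 4" "Suc k \<le> k3" "k3 \<le> k + 4"
    "Suc k \<le> Suc k3" "Suc k3 \<le> k + 4" "1 \<le> k1" "1 \<le> k2" "1 \<le> k3" by (auto simp: k1_def k2_def k3_def)
  obtain i1 where i1: "s \<le> i1" "i1 < s + int (fib k1) + int (fib k) - 1" "mismatch \<omega> k1 i1" using ex[of k1] le by blast
  obtain i2 where i2: "s \<le> i2" "i2 < s + int (fib k2) + int (fib k) - 1" "mismatch \<omega> k2 i2" using ex[of k2] le by blast
  obtain i3 where i3: "s \<le> i3" "i3 < s + int (fib k3) + int (fib k) - 1" "mismatch \<omega> k3 i3" using ex[of k3] le by blast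
  obtain i4 where i4: "s \<le> i4" "i4 < s + int (fib (Suc k3)) + int (fib k) - 1" "mismatch \<omega> (Suc k3) i4"
    using ex[of "Suc k3"] le by blast
  have f: "fib k2 = fib k1 + fib k" "fib k3 = fib k2 + fib k1" "fib (Suc k3) = fib k3 + fib k2"
    "fib (Suc (Suc k3)) = fib (Suc k3) + fib k3" "fib k \<le> fib k1"
    by (simp_all add: k1_def k2_def k3_def fib_Suc_mono)
  have "i2 - i1 = int (fib k1)"
    using mismatch_gap[OF le(9), of \<omega> i1 i2] i1 i2 f by (auto simp flip: k2_def k3_def)
  moreover have "i3 - i2 = int (fib k2)"
    using mismatch_gap[OF le(10), of \<omega> i2 i3] i2 i3 f by (auto simp flip: k3_def simp del: fib.simps)
  moreover have "i4 - i3 = int (fib k3)"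
    using mismatch_gap[OF le(11), of \<omega> i3 i4] i3 i4 f by (auto simp del: fib.simps)
  ultimately show False using i1 i4 f by linarith
qed

section \<open>Upper bounds for solutions\<close>

lemma solution_rec:
  assumes "is_solution V \<omega> (of_real E) u"
  shows "u (n + 1) + u (n - 1) = of_real (E - fib_potential V \<omega> n) * u n"
proof -
  have "u (n + 1) + u (n - 1) + of_real (fib_potential V \<omega> n) * u n = of_real E * u n"
    using assms by (simp add: is_solution_def fib_hamiltonian_def)
  then show ?thesis by (simp add: algebra_simps)
qed

lemma three_term_solution:
  assumes "3 \<le> k" "\<And>i. a \<le> i \<Longrightarrow> i < a + int (fib k) \<Longrightarrow> \<not> mismatch \<omega> k i"
    and u: "is_solution V \<omega> (of_real E) u"
  shows "u (a + 2 * int (fib k)) = of_real (fib_trace E V k) * u (a + int (fib k)) - u a"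
proof -
  have "Re (u (n + 1)) + Re (u (n - 1)) = (E - fib_potential V \<omega> n) * Re (u n)"
    "Im (u (n + 1)) + Im (u (n - 1)) = (E - fib_potential V \<omega> n) * Im (u n)" for n
    using arg_cong[OF solution_rec[OF u, of n], of Re] arg_cong[OF solution_rec[OF u, of n], of Im]
    by simp_all
  from three_term[OF assms(1,2) this(1)] three_term[OF assms(1,2) this(2)]
  show ?thesis by (simp add: complex_eq_iff)
qed

context
  fixes V E \<omega> T :: real and u :: "int \<Rightarrow> complex"
  assumes V: "0 \<le> V" and T: "1 \<le> T" and tr: "\<And>k. \<bar>fib_trace E V k\<bar> \<le> T"
    and u: "is_solution V \<omega> (of_real E) u"
    and normalized: "(norm (u 0))\<^sup>2 + (norm (u 1))\<^sup>2 = 1"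
begin

lemma coefficient_bound: "norm (of_real (E - fib_potential V \<omega> n) :: complex) \<le> T + V"
proof -
  have "\<bar>E\<bar> \<le> T" using tr[of 1] unfolding fib_trace_initial .
  then show ?thesis using V by (auto simp: fib_potential_eq abs_le_iff simp flip: of_real_diff)
qed

lemma norm_extrapolate:
  assumes "3 \<le> k" "\<And>i. a \<le> i \<Longrightarrow> i < a + int (fib k) \<Longrightarrow> \<not> mismatch \<omega> k i"
  shows "norm (u (a + 2 * int (fib k))) \<le> T * norm (u (a + int (fib k))) + norm (u a)"
    and "norm (u a) \<le> T * norm (u (a + int (fib k))) + norm (u (a + 2 * int (fib k)))"
proof -
  let ?t = "of_real (fib_trace E V k) :: complex"
  have e: "u (a + 2 * int (fib k)) = ?t * u (a + int (fib k)) - u a"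
    by (rule three_term_solution[OF assms u])
  have n: "norm (?t * u (a + int (fib k))) \<le> T * norm (u (a + int (fib k)))"
    unfolding norm_mult norm_of_real by (intro mult_right_mono tr) auto
  show "norm (u (a + 2 * int (fib k))) \<le> T * norm (u (a + int (fib k))) + norm (u a)"
    unfolding e using norm_triangle_ineq4[of "?t * u (a + int (fib k))" "u a"] n by linarith
  have "norm (u a) = norm (?t * u (a + int (fib k)) - u (a + 2 * int (fib k)))" using e by simp
  then show "norm (u a) \<le> T * norm (u (a + int (fib k))) + norm (u (a + 2 * int (fib k)))"
    using norm_triangle_ineq4[of "?t * u (a + int (fib k))" "u (a + 2 * int (fib k))"] n by linarith
qed

text \<open>Since F_k \<le> F_j \<le> F_(k+2) \<le> r for the good level \<open>j\<close>, moving
  \<open>n\<close> by F_j or 2 F_j towards the origin enters [-r, r] and does not leave it on the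
  far side.\<close>

lemma bound_extend:
  assumes "3 \<le> k" "int (fib (k + 2)) \<le> r" "0 \<le> B"
    and B: "\<And>i. \<bar>i\<bar> \<le> r \<Longrightarrow> norm (u i) \<le> B" and n: "\<bar>n\<bar> \<le> r + int (fib k)"
  shows "norm (u n) \<le> (1 + T) * B"
proof -
  have TB: "norm z \<le> (1 + T) * B" if "norm z \<le> T * norm x + norm y" "norm x \<le> B" "norm y \<le> B"
    for x y z :: complex
  proof -
    have "T * norm x \<le> T * B" using that T by (intro mult_left_mono) auto
    with that show ?thesis by (simp add: algebra_simps)
  qed
  consider "\<bar>n\<bar> \<le> r" | "r < n" | "n < - r" by linarith
  then show ?thesis
  proof cases
    case 1
    then have "norm (u n) \<le> 1 * B" using B by simp
    also have "\<dots> \<le> (1 + T) * B" using assms T by (intro mult_right_mono) auto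
    finally show ?thesis .
  next
    case 2
    obtain j where j: "k \<le> j" "j \<le> k + 2"
      "\<And>i. n - 2 * int (fib j) \<le> i \<Longrightarrow> i < n - int (fib j) \<Longrightarrow> \<not> mismatch \<omega> j i"
      using no_mismatch_left[of k n \<omega>] assms(1) by auto
    have f: "fib k \<le> fib j" "int (fib j) \<le> r" using fib_mono[OF j(1)] fib_mono[OF j(2)] assms(2) by auto
    have "norm (u (n - 2 * int (fib j) + 2 * int (fib j)))
      \<le> T * norm (u (n - 2 * int (fib j) + int (fib j))) + norm (u (n - 2 * int (fib j)))"
      using assms(1) j by (intro norm_extrapolate(1)) auto
    then show ?thesis using f 2 n
      by (intro TB[of _ "u (n - 2 * int (fib j) + int (fib j))" "u (n - 2 * int (fib j))"] B) auto
  next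
    case 3
    obtain j where j: "k \<le> j" "j \<le> k + 2"
      "\<And>i. n \<le> i \<Longrightarrow> i < n + int (fib j) \<Longrightarrow> \<not> mismatch \<omega> j i"
      using no_mismatch_right[of k n \<omega>] assms(1) by auto
    have f: "fib k \<le> fib j" "int (fib j) \<le> r" using fib_mono[OF j(1)] fib_mono[OF j(2)] assms(2) by auto
    have "norm (u n) \<le> T * norm (u (n + int (fib j))) + norm (u (n + 2 * int (fib j)))"
      using assms(1) j by (intro norm_extrapolate(2)) auto
    then show ?thesis using f 3 n
      by (intro TB[of _ "u (n + int (fib j))" "u (n + 2 * int (fib j))"] B) auto
  qed
qed

lemma bound_exponential: "norm (u (int m)) \<le> (1 + T + V) ^ m \<and> norm (u (- int m)) \<le> (1 + T + V) ^ Suc m"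
proof -
  have n01: "norm (u 0) \<le> 1" "norm (u 1) \<le> 1"
    using normalized by (smt (verit) one_power2 power2_le_imp_le zero_le_power2)+
  have step: "norm x \<le> (1 + T + V) ^ Suc m"
    if "x = of_real (E - fib_potential V \<omega> n) * y - z" "norm y \<le> (1 + T + V) ^ m" "norm z \<le> (1 + T + V) ^ m"
    for x y z :: complex and n m
  proof -
    have "norm x \<le> norm (of_real (E - fib_potential V \<omega> n) :: complex) * norm y + norm z"
      unfolding that(1) by (metis norm_mult norm_triangle_ineq4)
    also have "\<dots> \<le> (T + V) * (1 + T + V) ^ m + (1 + T + V) ^ m"
      using that coefficient_bound T V by (intro add_mono mult_mono) auto
    finally show ?thesis by (simp add: algebra_simps)
  qed
  have le: "1 \<le> (1 + T + V) ^ m" for m using T V by (intro one_le_power) auto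
  have up: "x \<le> (1 + T + V) ^ Suc m" if "x \<le> (1 + T + V) ^ m" for x m
    by (rule order_trans[OF that power_increasing]) (use T V in auto)
  have r: "u (n + 1) = of_real (E - fib_potential V \<omega> n) * u n - u (n - 1)"
    "u (n - 1) = of_real (E - fib_potential V \<omega> n) * u n - u (n + 1)" for n
    using solution_rec[OF u, of n] by (simp_all add: algebra_simps)
  have "norm (u (int m)) \<le> (1 + T + V) ^ m \<and> norm (u (int m + 1)) \<le> (1 + T + V) ^ Suc m \<and>
    norm (u (- int m)) \<le> (1 + T + V) ^ Suc m \<and> norm (u (1 - int m)) \<le> (1 + T + V) ^ m"
  proof (induction m)
    case 0
    show ?case using n01 le[of 1] by auto
  next
    case (Suc m)
    have "norm (u (int m + 1 + 1)) \<le> (1 + T + V) ^ Suc (Suc m)"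
    proof (rule step[OF r(1)[of "int m + 1"]])
      show "norm (u (int m + 1)) \<le> (1 + T + V) ^ Suc m" using Suc by blast
      show "norm (u (int m + 1 - 1)) \<le> (1 + T + V) ^ Suc m" using Suc up by (simp del: power_Suc)
    qed
    moreover have "norm (u (- int m - 1)) \<le> (1 + T + V) ^ Suc (Suc m)"
    proof (rule step[OF r(2)[of "- int m"]])
      show "norm (u (- int m)) \<le> (1 + T + V) ^ Suc m" using Suc by blast
      show "norm (u (- int m + 1)) \<le> (1 + T + V) ^ Suc m" using Suc up by (simp del: power_Suc)
    qed
    moreover have "int (Suc m) = int m + 1" "- int (Suc m) = - int m - 1" "1 - int (Suc m) = - int m"
      by simp_all
    ultimately show ?case using Suc by metis
  qed
  then show ?thesis by blast
qed

text \<open>F_(k+6) \<le> F_(k+5) + 2 F_(k+3), so two extensions, each costing 1 + T, raise the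
  level by one. The offset 5 makes k + 3 an admissible level in \<open>bound_extend\<close>.\<close>

lemma bound_fib:
  assumes "\<bar>i\<bar> \<le> int (fib (k + 5))"
  shows "norm (u i) \<le> (1 + T + V) ^ 6 * ((1 + T)\<^sup>2) ^ k"
  using assms
proof (induction k arbitrary: i)
  case 0
  have "fib 5 = 5" by (simp add: numeral_eq_Suc)
  then have "\<bar>i\<bar> \<le> 5" using 0 by simp
  then have "norm (u i) \<le> (1 + T + V) ^ Suc (nat \<bar>i\<bar>)"
  proof (cases "0 \<le> i")
    case True
    then have "norm (u i) \<le> (1 + T + V) ^ nat \<bar>i\<bar>" using bound_exponential[of "nat \<bar>i\<bar>"] by simp
    also have "\<dots> \<le> (1 + T + V) ^ Suc (nat \<bar>i\<bar>)" using T V by (intro power_increasing) auto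
    finally show ?thesis .
  qed (use bound_exponential[of "nat \<bar>i\<bar>"] in simp)
  also have "\<dots> \<le> (1 + T + V) ^ 6"
    using \<open>\<bar>i\<bar> \<le> 5\<close> T V by (intro power_increasing) auto
  finally show ?case by simp
next
  case (Suc k)
  let ?B = "(1 + T + V) ^ 6 * ((1 + T)\<^sup>2) ^ k"
  have B0: "0 \<le> ?B" using T V by simp
  let ?k = "k + 3"
  have f: "fib (Suc k + 5) = fib (k + 5) + fib (k + 4)" "fib (k + 4) = fib ?k + fib (k + 2)" "fib (k + 2) \<le> fib ?k"
    using fib_plus_2[of "k + 4"] fib_plus_2[of "k + 2"] fib_mono[of "k + 2" "k + 3"]
    by (simp_all add: eval_nat_numeral)
  have k5: "5 + k = k + 5" by simp
  have 1: "norm (u n) \<le> (1 + T) * ?B" if "\<bar>n\<bar> \<le> int (fib (k + 5)) + int (fib ?k)" for n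
    by (rule bound_extend[OF _ _ B0 Suc.IH that]) (simp_all add: k5)
  have "norm (u i) \<le> (1 + T) * ((1 + T) * ?B)"
  proof (rule bound_extend[OF _ _ _ 1])
    show "\<bar>i\<bar> \<le> int (fib (k + 5)) + int (fib ?k) + int (fib ?k)"
      using Suc.prems f by linarith
  qed (use B0 T in \<open>simp_all add: k5\<close>)
  then show ?case by (simp add: power2_eq_square mult_ac)
qed

section \<open>Lower bounds for the local mass\<close>

lemma initial_mass: "1 / ((T + V)\<^sup>2 + 2) \<le> (norm (u 1))\<^sup>2 + (norm (u 2))\<^sup>2"
proof -
  let ?K = "T + V" and ?x = "norm (u 1)" and ?y = "norm (u 2)"
  have "u 0 = of_real (E - fib_potential V \<omega> 1) * u 1 - u 2"
    using solution_rec[OF u, of 1] by (simp add: algebra_simps)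
  then have "norm (u 0) \<le> norm (of_real (E - fib_potential V \<omega> 1) :: complex) * ?x + ?y"
    by (metis norm_mult norm_triangle_ineq4)
  also have "\<dots> \<le> ?K * ?x + ?y" using coefficient_bound by (intro add_mono mult_right_mono) auto
  finally have "(norm (u 0))\<^sup>2 \<le> (?K * ?x + ?y)\<^sup>2" by (intro power_mono) auto
  moreover have "0 \<le> (?x - ?K * ?y)\<^sup>2" by simp
  then have "(?K * ?x + ?y)\<^sup>2 \<le> (?K\<^sup>2 + 1) * (?x\<^sup>2 + ?y\<^sup>2)"
    by (simp add: power2_eq_square algebra_simps)
  \<comment> \<open>The last summand bounds the share of \<open>u 1\<close> in the normalization and
    turns K^2 + 1 into K^2 + 2.\<close>
  ultimately have "1 \<le> (?K\<^sup>2 + 1) * (?x\<^sup>2 + ?y\<^sup>2) + (?x\<^sup>2 + ?y\<^sup>2)"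
    using normalized zero_le_power2[of ?y] by linarith
  then have "1 \<le> (?x\<^sup>2 + ?y\<^sup>2) * (?K\<^sup>2 + 2)" by (simp add: algebra_simps)
  moreover have "0 < ?K\<^sup>2 + 2" using zero_le_power2[of ?K] by linarith
  ultimately show ?thesis by (simp add: pos_divide_le_eq)
qed

text \<open>Backward extrapolation and Cauchy-Schwarz show that the translates of [1, F_k] by p =
  F_j and 2 p together carry at least the fraction 1 / (T^2 + 1) of its mass. The three blocks are
  disjoint because p \<ge> F_k, and fit because 2 F_(k+4) + F_k \<le> F_(k+6).\<close>

lemma mass_growth:
  assumes "2 \<le> k"
  shows "(1 + 1 / (T\<^sup>2 + 1)) * (\<Sum>n = 1..int (fib k). (norm (u n))\<^sup>2)
    \<le> (\<Sum>n = 1..int (fib (k + 6)). (norm (u n))\<^sup>2)"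
proof -
  define g where "g = (\<lambda>n. (norm (u n))\<^sup>2)"
  define L where "L = int (fib k)"
  obtain j where j: "Suc k \<le> j" "j \<le> k + 4"
    "\<And>i. 1 \<le> i \<Longrightarrow> i < 1 + int (fib j) + int (fib k) - 1 \<Longrightarrow> \<not> mismatch \<omega> j i"
    using no_mismatch_long[of k 1 \<omega>] assms by auto
  define p where "p = int (fib j)"
  have pL: "L \<le> p" using fib_mono[of k j] j by (simp add: L_def p_def)
  have "int (fib j) \<le> int (fib (k + 4))" using fib_mono[OF j(2)] by simp
  moreover have "fib (k + 6) = 2 * fib (k + 4) + fib (k + 3)" "fib k \<le> fib (k + 3)"
    using fib_plus_2[of "k + 4"] fib_plus_2[of "k + 3"] fib_mono[of k "k + 3"]
    by (simp_all add: eval_nat_numeral)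
  ultimately have hi: "2 * p + L \<le> int (fib (k + 6))" by (simp add: p_def L_def)
  have "g a \<le> (T\<^sup>2 + 1) * (g (a + p) + g (a + 2 * p))" if "a \<in> {1..L}" for a
  proof -
    let ?x = "norm (u (a + p))" and ?y = "norm (u (a + 2 * p))"
    have "norm (u a) \<le> T * ?x + ?y"
      unfolding p_def using assms j that by (intro norm_extrapolate(2)) (auto simp: L_def)
    then have "g a \<le> (T * ?x + ?y)\<^sup>2" unfolding g_def by (intro power_mono) auto
    also have "0 \<le> (?x - T * ?y)\<^sup>2" by simp
    then have "(T * ?x + ?y)\<^sup>2 \<le> (T\<^sup>2 + 1) * (?x\<^sup>2 + ?y\<^sup>2)"
      by (simp add: power2_eq_square algebra_simps)
    finally show ?thesis by (simp add: g_def)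
  qed
  then have "sum g {1..L} \<le> (\<Sum>a\<in>{1..L}. (T\<^sup>2 + 1) * (g (a + p) + g (a + 2 * p)))"
    by (rule sum_mono)
  also have "\<dots> = (T\<^sup>2 + 1) * ((\<Sum>a\<in>{1..L}. g (a + p)) + (\<Sum>a\<in>{1..L}. g (a + 2 * p)))"
    by (simp add: sum.distrib flip: sum_distrib_left)
  also have "(\<Sum>a\<in>{1..L}. g (a + p)) = sum g {1 + p..L + p}"
    by (rule sum.reindex_bij_witness[of _ "\<lambda>a. a - p" "\<lambda>a. a + p"]) auto
  also have "(\<Sum>a\<in>{1..L}. g (a + 2 * p)) = sum g {1 + 2 * p..L + 2 * p}"
    by (rule sum.reindex_bij_witness[of _ "\<lambda>a. a - 2 * p" "\<lambda>a. a + 2 * p"]) auto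
  finally have 1: "sum g {1..L} \<le> (T\<^sup>2 + 1) * (sum g {1 + p..L + p} + sum g {1 + 2 * p..L + 2 * p})" .
  have "sum g {1..L} + sum g {1 + p..L + p} + sum g {1 + 2 * p..L + 2 * p}
    = sum g ({1..L} \<union> {1 + p..L + p} \<union> {1 + 2 * p..L + 2 * p})"
    using pL by (subst sum.union_disjoint; (subst sum.union_disjoint)?) auto
  also have "\<dots> \<le> sum g {1..int (fib (k + 6))}"
    using pL hi by (intro sum_mono2) (auto simp: g_def L_def)
  finally have 2: "sum g {1..L} + (sum g {1 + p..L + p} + sum g {1 + 2 * p..L + 2 * p})
    \<le> sum g {1..int (fib (k + 6))}" by simp
  have "0 < T\<^sup>2 + 1" using zero_le_power2[of T] by linarith
  then have "sum g {1..L} / (T\<^sup>2 + 1) \<le> sum g {1 + p..L + p} + sum g {1 + 2 * p..L + 2 * p}"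
    using 1 by (simp add: pos_divide_le_eq mult.commute)
  with 2 show ?thesis by (simp add: g_def L_def algebra_simps)
qed

text \<open>Iteration of \<open>mass_growth\<close> from F_3 = 2, where \<open>initial_mass\<close>
  accounts for the sites 1 and 2.\<close>

lemma mass_fib:
  "(1 + 1 / (T\<^sup>2 + 1)) ^ q * (1 / ((T + V)\<^sup>2 + 2)) \<le> (\<Sum>n = 1..int (fib (3 + 6 * q)). (norm (u n))\<^sup>2)"
proof (induction q)
  case 0
  have "fib 3 = 2" by (simp add: numeral_eq_Suc)
  moreover have "{1..2::int} = {1, 2}" by auto
  ultimately show ?case using initial_mass by simp
next
  case (Suc q)
  have "0 \<le> 1 + 1 / (T\<^sup>2 + 1)" using zero_le_power2[of T] by simp
  then have "(1 + 1 / (T\<^sup>2 + 1)) ^ Suc q * (1 / ((T + V)\<^sup>2 + 2))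
    \<le> (1 + 1 / (T\<^sup>2 + 1)) * (\<Sum>n = 1..int (fib (3 + 6 * q)). (norm (u n))\<^sup>2)"
    using mult_left_mono[OF Suc] by (simp add: mult.assoc)
  also have "\<dots> \<le> (\<Sum>n = 1..int (fib (3 + 6 * Suc q)). (norm (u n))\<^sup>2)"
    using mass_growth[of "3 + 6 * q"] by (simp add: algebra_simps)
  finally show ?case .
qed

end

section \<open>Symmetric matrices with an approximate eigenvector\<close>

text \<open>Compactness gives a minimizer and scaling extends the inequality to all
  \<open>h\<close>. Vectors are functions on a whole type, so the unit sphere is placed inside the
  compact product \<open>S\<close>, with value 0 off \<open>X\<close>.\<close>

lemma symmetric_minimizer:
  fixes B :: "'a \<Rightarrow> 'a \<Rightarrow> real" and X :: "'a set"
  defines "app \<equiv> \<lambda>g i. \<Sum>j\<in>X. B i j * g j"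
  assumes X: "finite X" and f: "\<exists>i\<in>X. f i \<noteq> (0::real)"
  obtains g where "(\<Sum>i\<in>X. (g i)\<^sup>2) = 1"
    "\<And>h. (\<Sum>i\<in>X. (app g i)\<^sup>2) * (\<Sum>i\<in>X. (h i)\<^sup>2) \<le> (\<Sum>i\<in>X. (app h i)\<^sup>2)"
proof -
  define S where "S = PiE UNIV (\<lambda>i. if i \<in> X then {-1..1} else {0::real})"
  define N where "N = (\<lambda>g::'a \<Rightarrow> real. \<Sum>i\<in>X. (g i)\<^sup>2)"
  define Q where "Q = (\<lambda>g. \<Sum>i\<in>X. (app g i)\<^sup>2)"
  have "compactin (product_topology (\<lambda>_. euclidean) UNIV) S"
    unfolding S_def compactin_PiE by auto
  then have cS: "compact S" unfolding euclidean_product_topology by simp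
  have cN: "continuous_on UNIV N" unfolding N_def by (intro continuous_intros continuous_on_product_coordinates)
  have cQ: "continuous_on UNIV Q" unfolding Q_def app_def by (intro continuous_intros continuous_on_product_coordinates)
  have "closed (N -` {1})" using cN by (simp add: closed_vimage)
  then have c: "compact (S \<inter> N -` {1})" using cS by (rule compact_Int_closed[rotated])
  have norm1: "\<exists>g\<in>S \<inter> N -` {1}. Q g * N h = Q h" if "N h \<noteq> 0" for h
  proof -
    have pos: "0 < N h" using that by (simp add: N_def sum_nonneg less_le)
    define g where "g = (\<lambda>i. if i \<in> X then h i / sqrt (N h) else 0)"
    have Ng: "N g = 1"
    proof -
      have "N g = (\<Sum>i\<in>X. (h i)\<^sup>2 / N h)" unfolding N_def[of] using pos
        by (intro sum.cong) (auto simp: g_def power_divide N_def)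
      also have "\<dots> = N h / N h" by (simp only: N_def flip: sum_divide_distrib)
      finally show ?thesis using pos by simp
    qed
    have "(g i)\<^sup>2 \<le> 1" if "i \<in> X" for i
      using member_le_sum[of i X "\<lambda>i. (g i)\<^sup>2"] that X Ng by (simp add: N_def)
    then have "g i \<in> {-1..1}" if "i \<in> X" for i using that unfolding abs_square_le_1 by (auto simp: abs_le_iff)
    moreover have "g i = 0" if "i \<notin> X" for i using that by (simp add: g_def)
    ultimately have "g \<in> S" by (auto simp: S_def)
    have "app g i = app h i / sqrt (N h)" for i
      unfolding app_def sum_divide_distrib by (intro sum.cong) (auto simp: g_def)
    then have "Q g = Q h / N h" using pos by (simp add: Q_def power_divide sum_divide_distrib)
    then have "Q g * N h = Q h" using pos by simp
    then show ?thesis using \<open>g \<in> S\<close> Ng by blast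
  qed
  have "N f \<noteq> 0" using f X by (auto simp: N_def sum_nonneg_eq_0_iff)
  then have "S \<inter> N -` {1} \<noteq> {}" using norm1 by blast
  then obtain g where g: "g \<in> S \<inter> N -` {1}" "\<And>h. h \<in> S \<inter> N -` {1} \<Longrightarrow> Q g \<le> Q h"
    using continuous_attains_inf[OF c, of Q] continuous_on_subset[OF cQ subset_UNIV] by blast
  have "Q g * N h \<le> Q h" for h
  proof (cases "N h = 0")
    case False
    from norm1[OF this] obtain g' where "g' \<in> S \<inter> N -` {1}" "Q g' * N h = Q h" by blast
    moreover have "0 \<le> N h" by (simp add: N_def sum_nonneg)
    ultimately show ?thesis using g(2)[of g'] mult_right_mono[of "Q g" "Q g'" "N h"] by simp
  qed (simp add: Q_def sum_nonneg)
  then show ?thesis using that[of g] g(1) by (simp add: N_def Q_def)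
qed

lemma quadratic_nonneg_imp_linear_zero:
  fixes b c :: real
  assumes "\<And>t. 0 \<le> t * b + t\<^sup>2 * c"
  shows "b = 0"
proof (rule ccontr)
  assume b: "b \<noteq> 0"
  \<comment> \<open>Any positive d > c makes the value b^2 (c - d) / d^2 at t = -b/d
    negative.\<close>
  define d where "d = \<bar>c\<bar> + 1"
  have d: "0 < d" "c < d" by (auto simp: d_def)
  have "0 \<le> - b / d * b + (- b / d)\<^sup>2 * c" by (rule assms)
  also have "\<dots> = b\<^sup>2 / d\<^sup>2 * (c - d)" using d by (simp add: field_simps power2_eq_square)
  also have "\<dots> < 0" using b d by (intro mult_pos_neg) auto
  finally show False by simp
qed

text \<open>Minimizing \<open>\<parallel>B f\<parallel>\<^sup>2\<close> over the unit sphere gives an eigenvector of \<open>B\<^sup>2\<close> with eigenvalue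
  \<open>s\<^sup>2\<close>; since \<open>(B - s) (B + s)\<close> annihilates it, \<open>s\<close> or \<open>- s\<close> is an eigenvalue of \<open>B\<close>.\<close>

lemma symmetric_eigenvalue_near_0:
  fixes B :: "'a \<Rightarrow> 'a \<Rightarrow> real" and X :: "'a set"
  defines "app \<equiv> \<lambda>g i. \<Sum>j\<in>X. B i j * g j"
  assumes X: "finite X" and sym: "\<And>i j. B i j = B j i"
    and f: "\<exists>i\<in>X. f i \<noteq> 0" "(\<Sum>i\<in>X. (app f i)\<^sup>2) \<le> \<epsilon>\<^sup>2 * (\<Sum>i\<in>X. (f i)\<^sup>2)" and \<epsilon>: "0 \<le> \<epsilon>"
  shows "\<exists>s w. \<bar>s\<bar> \<le> \<epsilon> \<and> (\<exists>i\<in>X. w i \<noteq> 0) \<and> (\<forall>i\<in>X. app w i = s * w i)"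
proof -
  let ?ip = "\<lambda>g h. \<Sum>i\<in>X. g i * h i"
  obtain g where g: "(\<Sum>i\<in>X. (g i)\<^sup>2) = 1"
    "\<And>h. (\<Sum>i\<in>X. (app g i)\<^sup>2) * (\<Sum>i\<in>X. (h i)\<^sup>2) \<le> (\<Sum>i\<in>X. (app h i)\<^sup>2)"
    unfolding app_def using symmetric_minimizer[OF X f(1), of B] by blast
  define m where "m = (\<Sum>i\<in>X. (app g i)\<^sup>2)"
  have m0: "0 \<le> m" by (simp add: m_def sum_nonneg)
  have "(\<Sum>i\<in>X. (f i)\<^sup>2) \<noteq> 0" using f X by (auto simp: sum_nonneg_eq_0_iff)
  then have Nf: "0 < (\<Sum>i\<in>X. (f i)\<^sup>2)" by (simp add: sum_nonneg less_le)
  have "m * (\<Sum>i\<in>X. (f i)\<^sup>2) \<le> \<epsilon>\<^sup>2 * (\<Sum>i\<in>X. (f i)\<^sup>2)" unfolding m_def using g(2)[of f] f(2) by simp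
  then have me: "m \<le> \<epsilon>\<^sup>2" using Nf by simp
  have selfadj: "?ip (app p) q = ?ip p (app q)" for p q
  proof -
    have "?ip (app p) q = (\<Sum>i\<in>X. \<Sum>j\<in>X. B i j * p j * q i)" by (simp add: app_def sum_distrib_right)
    also have "\<dots> = (\<Sum>j\<in>X. \<Sum>i\<in>X. B i j * p j * q i)" by (rule sum.swap)
    also have "\<dots> = ?ip p (app q)"
      by (simp add: app_def sum_distrib_left) (intro sum.cong refl, subst sym, simp)
    finally show ?thesis .
  qed
  have lin: "app (\<lambda>i. p i + t * q i) = (\<lambda>i. app p i + t * app q i)" for p q t
    by (rule ext) (simp add: app_def algebra_simps sum.distrib sum_distrib_left)
  have sq: "(\<Sum>i\<in>X. (p i + t * q i)\<^sup>2) = ?ip p p + 2 * t * ?ip p q + t\<^sup>2 * ?ip q q" for p q :: "'a \<Rightarrow> real" and t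
    by (simp add: power2_eq_square algebra_simps sum.distrib sum_distrib_left)
  \<comment> \<open>The Euler-Lagrange equation: replacing \<open>g\<close> by g + t h gives an
    inequality that is an equality at t = 0, so its linear coefficient vanishes.\<close>
  have EL: "?ip (app (app g)) h = m * ?ip g h" for h
  proof -
    have "2 * (?ip (app g) (app h) - m * ?ip g h) = 0"
    proof (rule quadratic_nonneg_imp_linear_zero)
      fix t :: real
      have "m * (\<Sum>i\<in>X. (g i + t * h i)\<^sup>2) \<le> (\<Sum>i\<in>X. (app g i + t * app h i)\<^sup>2)"
        using g(2)[of "\<lambda>i. g i + t * h i"] unfolding lin m_def .
      moreover have "?ip g g = 1" "?ip (app g) (app g) = m" using g(1) by (simp_all add: m_def power2_eq_square)
      ultimately show "0 \<le> t * (2 * (?ip (app g) (app h) - m * ?ip g h)) + t\<^sup>2 * (?ip (app h) (app h) - m * ?ip h h)"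
        unfolding sq by (simp add: algebra_simps)
    qed
    then show ?thesis using selfadj[of "app g" h] by simp
  qed
  have eig2: "app (app g) i = m * g i" if "i \<in> X" for i
    using EL[of "\<lambda>j. if j = i then 1 else 0"] X that by (simp add: if_distrib cong: if_cong)
  define s where "s = sqrt m"
  have s: "s * s = m" "0 \<le> s" "s \<le> \<epsilon>" using m0 me \<epsilon> by (auto simp: s_def real_le_lsqrt)
  have congX: "app p i = app q i" if "\<And>j. j \<in> X \<Longrightarrow> p j = q j" for p q i
    unfolding app_def using that by (intro sum.cong) auto
  define w where "w = (\<lambda>i. app g i + s * g i)"
  show ?thesis
  proof (cases "\<exists>i\<in>X. w i \<noteq> 0")
    case True
    have "app w i = s * w i" if "i \<in> X" for i
      unfolding w_def lin using eig2[OF that] s(1) by (simp add: algebra_simps)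
    then show ?thesis using True s by (intro exI[of _ s] exI[of _ w]) auto
  next
    case False
    have "\<exists>i\<in>X. g i \<noteq> 0" using g(1) by (metis (mono_tags, lifting) power_zero_numeral sum.neutral zero_neq_one)
    moreover have "app g i = - s * g i" if "i \<in> X" for i using False that by (auto simp: w_def)
    ultimately show ?thesis using s by (intro exI[of _ "- s"] exI[of _ g]) auto
  qed
qed

text \<open>Symmetry cancels the cross term of |(A - z) f|^2, leaving |(A - Re z) f|^2 + (Im z)^2
  |f|^2. So Im z is small, and the real or the imaginary part of \<open>f\<close> is an approximate
  eigenvector at Re z.\<close>

lemma symmetric_eigenvalue_near:
  fixes A :: "'a \<Rightarrow> 'a \<Rightarrow> real" and X :: "'a set" and f :: "'a \<Rightarrow> complex" and z :: complex
  defines "app \<equiv> \<lambda>g i. \<Sum>j\<in>X. A i j * g j"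
  assumes X: "finite X" and sym: "\<And>i j. A i j = A j i" and \<epsilon>: "0 < \<epsilon>"
    and f: "(\<Sum>i\<in>X. (norm ((\<Sum>j\<in>X. of_real (A i j) * f j) - z * f i))\<^sup>2) < \<epsilon>\<^sup>2 * (\<Sum>i\<in>X. (norm (f i))\<^sup>2)"
  obtains lam w where "\<bar>Im z\<bar> \<le> \<epsilon>" "\<bar>lam - Re z\<bar> \<le> \<epsilon>" "\<exists>i\<in>X. w i \<noteq> 0" "\<And>i. i \<in> X \<Longrightarrow> app w i = lam * w i"
proof -
  let ?ip = "\<lambda>g h. \<Sum>i\<in>X. g i * h i"
  define B where "B = (\<lambda>i j. A i j - (if i = j then Re z else 0))"
  define Bp where "Bp = (\<lambda>g i. \<Sum>j\<in>X. B i j * g j)"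
  define p where "p = (\<lambda>i. Re (f i))"
  define q where "q = (\<lambda>i. Im (f i))"
  define y where "y = Im z"
  have Bt: "B i j * g j = A i j * g j - (if i = j then Re z * g j else 0)" for g i j
    by (simp add: B_def left_diff_distrib)
  have Bp: "Bp g i = app g i - Re z * g i" if "i \<in> X" for g i
    using X that by (simp add: Bp_def Bt app_def sum_subtractf)
  have symB: "B i j = B j i" for i j using sym by (simp add: B_def)
  have selfadj: "?ip (Bp p) q = ?ip p (Bp q)"
  proof -
    have "?ip (Bp p) q = (\<Sum>i\<in>X. \<Sum>j\<in>X. B i j * p j * q i)" by (simp add: Bp_def sum_distrib_right)
    also have "\<dots> = (\<Sum>j\<in>X. \<Sum>i\<in>X. B i j * p j * q i)" by (rule sum.swap)
    also have "\<dots> = ?ip p (Bp q)"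
      by (simp add: Bp_def sum_distrib_left) (intro sum.cong refl, subst symB, simp)
    finally show ?thesis .
  qed
  have "(norm ((\<Sum>j\<in>X. of_real (A i j) * f j) - z * f i))\<^sup>2
    = (Bp p i)\<^sup>2 + (Bp q i)\<^sup>2 + y\<^sup>2 * ((p i)\<^sup>2 + (q i)\<^sup>2) + 2 * y * (Bp p i * q i - p i * Bp q i)"
    if "i \<in> X" for i
  proof -
    have re: "Re ((\<Sum>j\<in>X. of_real (A i j) * f j) - z * f i) = Bp p i + y * q i"
      and im: "Im ((\<Sum>j\<in>X. of_real (A i j) * f j) - z * f i) = Bp q i - y * p i"
      unfolding Bp[OF that] by (simp_all add: app_def p_def q_def y_def)
    show ?thesis unfolding cmod_power2 re im by (simp add: power2_eq_square algebra_simps)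
  qed
  then have "(\<Sum>i\<in>X. (norm ((\<Sum>j\<in>X. of_real (A i j) * f j) - z * f i))\<^sup>2)
    = (\<Sum>i\<in>X. (Bp p i)\<^sup>2 + (Bp q i)\<^sup>2 + y\<^sup>2 * ((p i)\<^sup>2 + (q i)\<^sup>2) + 2 * y * (Bp p i * q i - p i * Bp q i))"
    by (intro sum.cong) auto
  also have "\<dots> = (\<Sum>i\<in>X. (Bp p i)\<^sup>2) + (\<Sum>i\<in>X. (Bp q i)\<^sup>2) + y\<^sup>2 * ((\<Sum>i\<in>X. (p i)\<^sup>2) + (\<Sum>i\<in>X. (q i)\<^sup>2))
      + 2 * y * (?ip (Bp p) q - ?ip p (Bp q))"
    unfolding sum.distrib sum_distrib_left[symmetric] sum_subtractf ..
  finally have less: "(\<Sum>i\<in>X. (Bp p i)\<^sup>2) + (\<Sum>i\<in>X. (Bp q i)\<^sup>2) + y\<^sup>2 * ((\<Sum>i\<in>X. (p i)\<^sup>2) + (\<Sum>i\<in>X. (q i)\<^sup>2))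
    < \<epsilon>\<^sup>2 * ((\<Sum>i\<in>X. (p i)\<^sup>2) + (\<Sum>i\<in>X. (q i)\<^sup>2))"
    using f unfolding selfadj by (simp add: cmod_power2 p_def q_def sum.distrib)
  have nn: "0 \<le> (\<Sum>i\<in>X. (g i)\<^sup>2)" for g :: "'a \<Rightarrow> real" by (simp add: sum_nonneg)
  have "y\<^sup>2 * ((\<Sum>i\<in>X. (p i)\<^sup>2) + (\<Sum>i\<in>X. (q i)\<^sup>2)) \<le> \<epsilon>\<^sup>2 * ((\<Sum>i\<in>X. (p i)\<^sup>2) + (\<Sum>i\<in>X. (q i)\<^sup>2))"
    using less nn[of "Bp p"] nn[of "Bp q"] by linarith
  moreover have "0 < (\<Sum>i\<in>X. (p i)\<^sup>2) + (\<Sum>i\<in>X. (q i)\<^sup>2)"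
  proof (rule ccontr)
    assume "\<not> ?thesis"
    then have "(\<Sum>i\<in>X. (p i)\<^sup>2) + (\<Sum>i\<in>X. (q i)\<^sup>2) = 0" using nn[of p] nn[of q] by linarith
    then show False using less nn[of "Bp p"] nn[of "Bp q"] by simp
  qed
  ultimately have "y\<^sup>2 \<le> \<epsilon>\<^sup>2" by simp
  then have im: "\<bar>Im z\<bar> \<le> \<epsilon>" using \<epsilon> abs_le_square_iff[of y \<epsilon>] by (simp add: y_def)
  have "0 \<le> y\<^sup>2 * ((\<Sum>i\<in>X. (p i)\<^sup>2) + (\<Sum>i\<in>X. (q i)\<^sup>2))" using nn[of p] nn[of q] by simp
  then have "(\<Sum>i\<in>X. (Bp p i)\<^sup>2) < \<epsilon>\<^sup>2 * (\<Sum>i\<in>X. (p i)\<^sup>2) \<or> (\<Sum>i\<in>X. (Bp q i)\<^sup>2) < \<epsilon>\<^sup>2 * (\<Sum>i\<in>X. (q i)\<^sup>2)"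
    using less unfolding distrib_left by linarith
  then obtain g where g: "(\<Sum>i\<in>X. (Bp g i)\<^sup>2) < \<epsilon>\<^sup>2 * (\<Sum>i\<in>X. (g i)\<^sup>2)" by blast
  have "\<exists>i\<in>X. g i \<noteq> 0"
  proof (rule ccontr)
    assume "\<not> ?thesis"
    then have "(\<Sum>i\<in>X. (g i)\<^sup>2) = 0" by simp
    then show False using g nn[of "Bp g"] by simp
  qed
  from symmetric_eigenvalue_near_0[OF X symB this less_imp_le[OF g[unfolded Bp_def]] less_imp_le[OF \<epsilon>]]
  obtain s w where w: "\<bar>s\<bar> \<le> \<epsilon>" "\<exists>i\<in>X. w i \<noteq> 0" "\<And>i. i \<in> X \<Longrightarrow> (\<Sum>j\<in>X. B i j * w j) = s * w i"
    by blast
  show ?thesis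
  proof (rule that[OF im _ w(2)])
    show "\<bar>(Re z + s) - Re z\<bar> \<le> \<epsilon>" using w(1) by simp
    fix i assume i: "i \<in> X"
    have "app w i - Re z * w i = s * w i" using w(3)[OF i] Bp[OF i, of w] by (simp add: Bp_def)
    then show "app w i = (Re z + s) * w i" by (simp add: algebra_simps)
  qed
qed

section \<open>The Hilbert space of square-summable sequences\<close>

text \<open>As an instance of \<open>real_inner\<close> and \<open>complete_space\<close>, the
  sequences are open to \<open>bounded_linear\<close> and the Banach fixed point theorem. The inner
  product is the real part of the complex one; complex multiples enter through
  \<open>cmult_op\<close>.\<close>

typedef ell2 = l2 morphisms coords Ell2
proof
  show "(\<lambda>_. 0) \<in> l2" by (simp add: l2_def)
qed

setup_lifting type_definition_ell2

lemma l2_add: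
  assumes "f \<in> l2" "g \<in> l2"
  shows "(\<lambda>n. f n + g n) \<in> l2"
proof -
  have "(norm (a + b))\<^sup>2 \<le> 2 * (norm a)\<^sup>2 + 2 * (norm b)\<^sup>2" for a b :: complex
  proof -
    have "(norm (a + b))\<^sup>2 \<le> (norm a + norm b)\<^sup>2" by (intro power_mono norm_triangle_ineq) auto
    moreover have "0 \<le> (norm a - norm b)\<^sup>2" by simp
    ultimately show ?thesis by (simp add: power2_eq_square algebra_simps)
  qed
  moreover have "(\<lambda>n. 2 * (norm (f n))\<^sup>2 + 2 * (norm (g n))\<^sup>2) summable_on UNIV"
    using assms by (intro summable_on_add summable_on_cmult_right) (auto simp: l2_def)
  ultimately show ?thesis unfolding l2_def by (auto intro: summable_on_comparison_test)
qed

lemma l2_mult_bounded: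
  assumes "f \<in> l2" "\<And>n. norm (c n) \<le> K"
  shows "(\<lambda>n. c n * f n) \<in> l2"
proof -
  have "(norm (c n * f n))\<^sup>2 \<le> K\<^sup>2 * (norm (f n))\<^sup>2" for n
    using assms(2)[of n] by (simp add: norm_mult power_mult_distrib power_mono mult_right_mono)
  moreover have "(\<lambda>n. K\<^sup>2 * (norm (f n))\<^sup>2) summable_on UNIV"
    using assms by (intro summable_on_cmult_right) (auto simp: l2_def)
  ultimately show ?thesis unfolding l2_def by (auto intro: summable_on_comparison_test)
qed

lemma l2_cmult: "f \<in> l2 \<Longrightarrow> (\<lambda>n. c * f n) \<in> l2"
  using l2_mult_bounded[of f "\<lambda>_. c" "norm c"] by simp

lemma bij_shift: "bij_betw (\<lambda>n::int. n + k) UNIV UNIV"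
  by (rule bij_betwI[where g = "\<lambda>n. n - k"]) auto

lemma l2_shift: "f \<in> l2 \<Longrightarrow> (\<lambda>n. f (n + k)) \<in> l2"
  unfolding l2_def using summable_on_reindex_bij_betw[OF bij_shift, of "\<lambda>n. (norm (f n))\<^sup>2" k] by simp

lemma summable_inner:
  assumes "f \<in> l2" "g \<in> l2"
  shows "(\<lambda>n. inner (f n) (g n)) summable_on UNIV"
proof (rule Infinite_Sum.abs_summable_summable, rule Infinite_Sum.abs_summable_on_comparison_test')
  show "(\<lambda>n. (norm (f n))\<^sup>2 + (norm (g n))\<^sup>2) summable_on UNIV"
    using assms by (intro summable_on_add) (auto simp: l2_def)
  show "norm (inner (f n) (g n)) \<le> (norm (f n))\<^sup>2 + (norm (g n))\<^sup>2" for n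
  proof -
    have "norm (inner (f n) (g n)) \<le> norm (f n) * norm (g n)" by (simp add: Cauchy_Schwarz_ineq2)
    moreover have "0 \<le> (norm (f n) - norm (g n))\<^sup>2" by simp
    moreover have "0 \<le> (norm (f n))\<^sup>2 + (norm (g n))\<^sup>2" by simp
    ultimately show ?thesis unfolding power2_diff by linarith
  qed
qed

instantiation ell2 :: real_inner
begin

lift_definition zero_ell2 :: ell2 is "\<lambda>_. 0" by (simp add: l2_def)
lift_definition plus_ell2 :: "ell2 \<Rightarrow> ell2 \<Rightarrow> ell2" is "\<lambda>f g n. f n + g n" by (rule l2_add)
lift_definition uminus_ell2 :: "ell2 \<Rightarrow> ell2" is "\<lambda>f n. - f n" by (simp add: l2_def)
lift_definition minus_ell2 :: "ell2 \<Rightarrow> ell2 \<Rightarrow> ell2" is "\<lambda>f g n. f n - g n"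
  subgoal for f g using l2_add[of f "\<lambda>n. - g n"] by (simp add: l2_def) done
lift_definition scaleR_ell2 :: "real \<Rightarrow> ell2 \<Rightarrow> ell2" is "\<lambda>r f n. r *\<^sub>R f n"
  by (simp add: scaleR_conv_of_real l2_cmult)
lift_definition inner_ell2 :: "ell2 \<Rightarrow> ell2 \<Rightarrow> real" is "\<lambda>f g. \<Sum>\<^sub>\<infinity>n. inner (f n) (g n)" .

definition norm_ell2 :: "ell2 \<Rightarrow> real" where "norm_ell2 x = sqrt (inner x x)"
definition dist_ell2 :: "ell2 \<Rightarrow> ell2 \<Rightarrow> real" where "dist_ell2 x y = norm (x - y)"
definition sgn_ell2 :: "ell2 \<Rightarrow> ell2" where "sgn_ell2 x = inverse (norm x) *\<^sub>R x"
definition uniformity_ell2 :: "(ell2 \<times> ell2) filter" where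
  "uniformity_ell2 = (INF e\<in>{0<..}. principal {(x, y). dist x y < e})"
definition open_ell2 :: "ell2 set \<Rightarrow> bool" where
  "open_ell2 U \<longleftrightarrow> (\<forall>x\<in>U. \<forall>\<^sub>F (x', y) in uniformity. x' = x \<longrightarrow> y \<in> U)"

instance
proof
  fix x y z :: ell2 and r s :: real
  show "x + y + z = x + (y + z)" by transfer (simp add: add.assoc)
  show "x + y = y + x" by transfer (simp add: add.commute)
  show "0 + x = x" by transfer simp
  show "- x + x = 0" by transfer simp
  show "x - y = x + - y" by transfer simp
  show "r *\<^sub>R (x + y) = r *\<^sub>R x + r *\<^sub>R y" by transfer (simp add: scaleR_right_distrib)
  show "(r + s) *\<^sub>R x = r *\<^sub>R x + s *\<^sub>R x" by transfer (simp add: scaleR_left_distrib)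
  show "r *\<^sub>R s *\<^sub>R x = (r * s) *\<^sub>R x" by transfer simp
  show "1 *\<^sub>R x = x" by transfer simp
  show "dist x y = norm (x - y)" by (rule dist_ell2_def)
  show "sgn x = inverse (norm x) *\<^sub>R x" by (rule sgn_ell2_def)
  show "uniformity = (INF e\<in>{0<..}. principal {(x, y::ell2). dist x y < e})"
    by (rule uniformity_ell2_def)
  show "open U \<longleftrightarrow> (\<forall>x\<in>U. \<forall>\<^sub>F (x', y) in uniformity. x' = x \<longrightarrow> y \<in> U)" for U :: "ell2 set"
    by (rule open_ell2_def)
  show "inner x y = inner y x" by transfer (simp add: inner_commute)
  show "inner (x + y) z = inner x z + inner y z"
    by transfer (simp add: inner_add_left infsum_add summable_inner)
  show "inner (r *\<^sub>R x) y = r * inner x y"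
    by transfer (simp add: infsum_cmult_right')
  show "0 \<le> inner x x" by transfer (simp add: infsum_nonneg)
  show "inner x x = 0 \<longleftrightarrow> x = 0"
  proof (transfer, rule iffI)
    fix f :: "int \<Rightarrow> complex" assume f: "f \<in> l2" "(\<Sum>\<^sub>\<infinity>n. inner (f n) (f n)) = 0"
    have "inner (f n) (f n) = 0" for n
      by (rule nonneg_infsum_le_0D[where f = "\<lambda>n. inner (f n) (f n)" and A = UNIV]) (use f summable_inner in auto)
    then show "f = (\<lambda>_. 0)" by auto
  qed simp
  show "norm x = sqrt (inner x x)" by (rule norm_ell2_def)
qed

end

lemma norm_ell2_sq: "(norm x)\<^sup>2 = (\<Sum>\<^sub>\<infinity>n. (norm (coords x n))\<^sup>2)"
  unfolding power2_norm_eq_inner inner_ell2.rep_eq ..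

lemma coords_l2: "coords x \<in> l2"
  by (rule coords)

lemma l2_norm_coords: "l2_norm (coords x) = norm x"
  by (simp add: l2_norm_def flip: norm_ell2_sq)

lemma sum_coords_le: "finite F \<Longrightarrow> (\<Sum>n\<in>F. (norm (coords x n))\<^sup>2) \<le> (norm x)\<^sup>2"
  unfolding norm_ell2_sq using coords_l2[of x] by (intro finite_sum_le_infsum) (auto simp: l2_def)

lemma norm_coord_le: "norm (coords x n) \<le> norm x"
  using sum_coords_le[of "{n}" x] by (simp add: power2_le_iff_abs_le)

text \<open>Coordinates converge because the norm dominates them. The Cauchy estimate for finite
  partial sums survives the limit in one index, which yields both membership of the limit in
  \<open>l2\<close> and convergence in norm.\<close>

instance ell2 :: complete_space
proof
  fix X :: "nat \<Rightarrow> ell2" assume X: "Cauchy X"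
  have "Cauchy (\<lambda>m. coords (X m) n)" for n
  proof (rule metric_CauchyI)
    fix e :: real assume "0 < e"
    from metric_CauchyD[OF X this] obtain M where M: "\<And>m k. M \<le> m \<Longrightarrow> M \<le> k \<Longrightarrow> dist (X m) (X k) < e" by blast
    have "dist (coords (X m) n) (coords (X k) n) \<le> dist (X m) (X k)" for m k
      using norm_coord_le[of "X m - X k" n] by (simp add: dist_norm minus_ell2.rep_eq)
    with M show "\<exists>M. \<forall>m\<ge>M. \<forall>k\<ge>M. dist (coords (X m) n) (coords (X k) n) < e"
      by (meson le_less_trans)
  qed
  then have "\<exists>l. (\<lambda>m. coords (X m) n) \<longlonglongrightarrow> l" for n by (simp add: Cauchy_convergent_iff convergent_def)
  then obtain g where g: "\<And>n. (\<lambda>m. coords (X m) n) \<longlonglongrightarrow> g n" by metis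
  have tail: "\<exists>M. \<forall>m\<ge>M. (\<lambda>n. coords (X m) n - g n) \<in> l2 \<and> (\<Sum>\<^sub>\<infinity>n. (norm (coords (X m) n - g n))\<^sup>2) \<le> e\<^sup>2"
    if e: "0 < e" for e
  proof -
    from metric_CauchyD[OF X e] obtain M where M: "\<And>m k. M \<le> m \<Longrightarrow> M \<le> k \<Longrightarrow> dist (X m) (X k) < e" by blast
    have F: "(\<Sum>n\<in>F. (norm (coords (X m) n - g n))\<^sup>2) \<le> e\<^sup>2" if F: "finite F" and m: "M \<le> m" for F m
    proof (rule LIMSEQ_le_const2)
      show "(\<lambda>k. \<Sum>n\<in>F. (norm (coords (X m) n - coords (X k) n))\<^sup>2) \<longlonglongrightarrow> (\<Sum>n\<in>F. (norm (coords (X m) n - g n))\<^sup>2)"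
        by (intro tendsto_intros g)
      have "(\<Sum>n\<in>F. (norm (coords (X m) n - coords (X k) n))\<^sup>2) \<le> e\<^sup>2" if "M \<le> k" for k
      proof -
        have "(\<Sum>n\<in>F. (norm (coords (X m) n - coords (X k) n))\<^sup>2) \<le> (norm (X m - X k))\<^sup>2"
          using sum_coords_le[OF F, of "X m - X k"] by (simp add: minus_ell2.rep_eq)
        also have "\<dots> \<le> e\<^sup>2" using M[OF m that] by (intro power_mono) (auto simp: dist_norm)
        finally show ?thesis .
      qed
      then show "\<exists>N. \<forall>k\<ge>N. (\<Sum>n\<in>F. (norm (coords (X m) n - coords (X k) n))\<^sup>2) \<le> e\<^sup>2" by blast
    qed
    have "(\<lambda>n. coords (X m) n - g n) \<in> l2" if m: "M \<le> m" for m
      unfolding l2_def mem_Collect_eq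
    proof (rule nonneg_bdd_above_summable_on)
      show "bdd_above (sum (\<lambda>n. (norm (coords (X m) n - g n))\<^sup>2) ` {F. F \<subseteq> UNIV \<and> finite F})"
        using F[OF _ m] by (intro bdd_aboveI[of _ "e\<^sup>2"]) auto
    qed simp
    moreover from this have "(\<Sum>\<^sub>\<infinity>n. (norm (coords (X m) n - g n))\<^sup>2) \<le> e\<^sup>2" if m: "M \<le> m" for m
      using F[OF _ m] m by (intro infsum_le_finite_sums) (auto simp: l2_def)
    ultimately show ?thesis by blast
  qed
  have "g \<in> l2"
  proof -
    obtain m where "(\<lambda>n. coords (X m) n - g n) \<in> l2" using tail[of 1] by auto
    from l2_add[OF coords_l2[of "X m"] l2_cmult[OF this, of "-1"]] show ?thesis by simp
  qed
  then have cg: "coords (Ell2 g) = g" by (rule Ell2_inverse)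
  have "X \<longlonglongrightarrow> Ell2 g"
  proof (rule metric_LIMSEQ_I)
    fix r :: real assume r: "0 < r"
    obtain M where M: "\<And>m. M \<le> m \<Longrightarrow> (\<Sum>\<^sub>\<infinity>n. (norm (coords (X m) n - g n))\<^sup>2) \<le> (r / 2)\<^sup>2"
      using tail[of "r / 2"] r by auto
    have "dist (X m) (Ell2 g) < r" if "M \<le> m" for m
    proof -
      have "(norm (X m - Ell2 g))\<^sup>2 \<le> (r / 2)\<^sup>2"
        unfolding norm_ell2_sq minus_ell2.rep_eq cg by (rule M[OF that])
      then have "norm (X m - Ell2 g) \<le> r / 2" by (rule power2_le_imp_le) (use r in simp)
      then show ?thesis using r by (simp add: dist_norm)
    qed
    then show "\<exists>no. \<forall>n\<ge>no. dist (X n) (Ell2 g) < r" by blast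
  qed
  then show "convergent X" by (auto simp: convergent_def)
qed

text \<open>Normality makes \<open>T\<close> and its adjoint \<open>T'\<close> bounded below simultaneously, so
  \<open>x \<mapsto> x - \<tau> T T' x + \<tau> y\<close> is a contraction for small \<open>\<tau>\<close>.\<close>

lemma normal_bounded_below_surj:
  fixes T T' :: "'a :: {real_inner, complete_space} \<Rightarrow> 'a"
  assumes T: "bounded_linear T" and T': "bounded_linear T'"
    and adj: "\<And>x y. inner (T x) y = inner x (T' y)" and comm: "\<And>x. T (T' x) = T' (T x)"
    and \<epsilon>: "0 < \<epsilon>" and below: "\<And>x. \<epsilon> * norm x \<le> norm (T x)"
  shows "\<exists>x. T x = y"
proof -
  interpret T: bounded_linear T by fact
  interpret T': bounded_linear T' by fact
  obtain K where K: "0 < K" "\<And>x. norm (T x) \<le> norm x * K" using T.pos_bounded by blast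
  have nT': "norm (T' x) = norm (T x)" for x
  proof -
    have "inner (T' x) (T' x) = inner (T (T' x)) x" by (simp add: adj)
    also have "\<dots> = inner x (T' (T x))" by (simp add: comm inner_commute)
    also have "\<dots> = inner (T x) (T x)" by (simp add: adj)
    finally show ?thesis by (simp add: norm_eq_sqrt_inner)
  qed
  \<comment> \<open>With \<tau> K^2 = 1 the quadratic term takes back at most half of the linear
    gain. In \<open>q\<close>, the maximum with 0 keeps the radicand nonnegative for every
    \<epsilon>.\<close>
  define \<tau> where "\<tau> = 1 / K\<^sup>2"
  have \<tau>: "0 < \<tau>" "\<tau> * K\<^sup>2 = 1" using K by (auto simp: \<tau>_def)
  define q where "q = sqrt (max 0 (1 - \<tau> * \<epsilon>\<^sup>2))"
  have q: "0 \<le> q" "q < 1" using \<tau> \<epsilon> by (auto simp: q_def)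
  have contr: "norm (w - \<tau> *\<^sub>R T (T' w)) \<le> q * norm w" for w
  proof -
    let ?s = "T' w"
    have "(norm (w - \<tau> *\<^sub>R T ?s))\<^sup>2 = (norm w)\<^sup>2 - 2 * \<tau> * inner (T ?s) w + \<tau>\<^sup>2 * (norm (T ?s))\<^sup>2"
      unfolding power2_norm_eq_inner
      by (simp add: inner_diff_left inner_diff_right inner_commute power2_eq_square algebra_simps)
    also have "inner (T ?s) w = (norm ?s)\<^sup>2" by (simp add: adj power2_norm_eq_inner)
    also have "(norm w)\<^sup>2 - 2 * \<tau> * (norm ?s)\<^sup>2 + \<tau>\<^sup>2 * (norm (T ?s))\<^sup>2
      \<le> (norm w)\<^sup>2 - 2 * \<tau> * (norm ?s)\<^sup>2 + \<tau>\<^sup>2 * (norm ?s * K)\<^sup>2"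
      using K by (intro add_left_mono mult_left_mono power_mono) auto
    also have "\<tau>\<^sup>2 * (norm ?s * K)\<^sup>2 = \<tau> * (\<tau> * K\<^sup>2) * (norm ?s)\<^sup>2" by (simp add: power2_eq_square)
    also have "(norm w)\<^sup>2 - 2 * \<tau> * (norm ?s)\<^sup>2 + \<tau> * (\<tau> * K\<^sup>2) * (norm ?s)\<^sup>2 = (norm w)\<^sup>2 - \<tau> * (norm ?s)\<^sup>2"
      by (simp add: \<tau>)
    also have "\<dots> \<le> (norm w)\<^sup>2 - \<tau> * (\<epsilon> * norm w)\<^sup>2"
      using \<tau> \<epsilon> below[of w] unfolding nT' by (intro diff_left_mono mult_left_mono power_mono) auto
    also have "\<dots> = (1 - \<tau> * \<epsilon>\<^sup>2) * (norm w)\<^sup>2" by (simp add: power_mult_distrib algebra_simps)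
    also have "\<dots> \<le> (q * norm w)\<^sup>2" by (auto simp: q_def power_mult_distrib intro: mult_right_mono)
    finally show ?thesis by (rule power2_le_imp_le) (simp add: q)
  qed
  define G where "G = (\<lambda>x. x - \<tau> *\<^sub>R T (T' x) + \<tau> *\<^sub>R y)"
  have "dist (G x) (G z) \<le> q * dist x z" for x z
  proof -
    have "G x - G z = (x - z) - \<tau> *\<^sub>R T (T' (x - z))"
      by (simp add: G_def T.diff T'.diff algebra_simps)
    then show ?thesis using contr[of "x - z"] by (simp add: dist_norm)
  qed
  then obtain x where "G x = x" using banach_fix_type[OF q, of G] by blast
  then have "\<tau> *\<^sub>R T (T' x) = \<tau> *\<^sub>R y" by (auto simp: G_def algebra_simps)
  then have "T (T' x) = y" using \<tau> by simp
  then show ?thesis ..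
qed

section \<open>The spectrum and the trace map\<close>

lift_definition shift_op :: "int \<Rightarrow> ell2 \<Rightarrow> ell2" is "\<lambda>k f n. f (n + k)"
  by (rule l2_shift)

lemma norm_potential_diff_le:
  "norm (of_real (fib_potential V \<omega> n) - z :: complex) \<le> \<bar>V\<bar> + norm z"
  using norm_triangle_ineq4[of "of_real (fib_potential V \<omega> n)" z] by (auto simp: fib_potential_eq)

lift_definition diag_op :: "real \<Rightarrow> real \<Rightarrow> complex \<Rightarrow> ell2 \<Rightarrow> ell2" is
  "\<lambda>V \<omega> z f n. (of_real (fib_potential V \<omega> n) - z) * f n"
  by (rule l2_mult_bounded[OF _ norm_potential_diff_le])

lift_definition cmult_op :: "complex \<Rightarrow> ell2 \<Rightarrow> ell2" is "\<lambda>c f n. c * f n"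
  by (rule l2_cmult)

text \<open>The operator H - z, with z absorbed into the diagonal: its adjoint is the same operator
  at the conjugate of z and commutes with it, which gives normality for all complex z.\<close>

definition fib_op :: "real \<Rightarrow> real \<Rightarrow> complex \<Rightarrow> ell2 \<Rightarrow> ell2" where
  "fib_op V \<omega> z x = shift_op 1 x + shift_op (-1) x + diag_op V \<omega> z x"

lemma coords_fib_op: "coords (fib_op V \<omega> z x) = (\<lambda>n. fib_hamiltonian V \<omega> (coords x) n - z * coords x n)"
  by (simp add: fib_op_def fib_hamiltonian_def plus_ell2.rep_eq shift_op.rep_eq diag_op.rep_eq algebra_simps)

lemma bounded_linear_shift_op: "bounded_linear (shift_op k)"
proof (rule bounded_linear_intro[where K = 1])
  fix x y :: ell2 and r :: real
  show "shift_op k (x + y) = shift_op k x + shift_op k y" by transfer simp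
  show "shift_op k (r *\<^sub>R x) = r *\<^sub>R shift_op k x" by transfer simp
  have "(norm (shift_op k x))\<^sup>2 = (norm x)\<^sup>2"
    unfolding norm_ell2_sq shift_op.rep_eq
    by (rule infsum_reindex_bij_betw[OF bij_shift, of "\<lambda>n. (norm (coords x n))\<^sup>2"])
  then show "norm (shift_op k x) \<le> norm x * 1" by simp
qed

lemma bounded_linear_diag_op: "bounded_linear (diag_op V \<omega> z)"
proof (rule bounded_linear_intro[where K = "\<bar>V\<bar> + norm z"])
  fix x y :: ell2 and r :: real
  let ?K = "\<bar>V\<bar> + norm z"
  show "diag_op V \<omega> z (x + y) = diag_op V \<omega> z x + diag_op V \<omega> z y"
    by transfer (simp add: algebra_simps)
  show "diag_op V \<omega> z (r *\<^sub>R x) = r *\<^sub>R diag_op V \<omega> z x" by transfer simp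
  have "(norm (diag_op V \<omega> z x))\<^sup>2 \<le> (\<Sum>\<^sub>\<infinity>n. ?K\<^sup>2 * (norm (coords x n))\<^sup>2)"
    unfolding norm_ell2_sq
  proof (rule infsum_mono)
    show "(\<lambda>n. (norm (coords (diag_op V \<omega> z x) n))\<^sup>2) summable_on UNIV"
      using coords_l2 by (auto simp: l2_def)
    show "(\<lambda>n. ?K\<^sup>2 * (norm (coords x n))\<^sup>2) summable_on UNIV"
      using coords_l2 by (intro summable_on_cmult_right) (auto simp: l2_def)
    show "(norm (coords (diag_op V \<omega> z x) n))\<^sup>2 \<le> ?K\<^sup>2 * (norm (coords x n))\<^sup>2" for n
      using norm_potential_diff_le[of V \<omega> n z]
      by (simp add: diag_op.rep_eq norm_mult power_mult_distrib power_mono mult_right_mono)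
  qed
  also have "\<dots> = (norm x * ?K)\<^sup>2"
    by (simp add: infsum_cmult_right' norm_ell2_sq power_mult_distrib)
  finally show "norm (diag_op V \<omega> z x) \<le> norm x * ?K" by (rule power2_le_imp_le) simp
qed

lemma bounded_linear_fib_op: "bounded_linear (fib_op V \<omega> z)"
  unfolding fib_op_def[abs_def]
  by (intro bounded_linear_add bounded_linear_shift_op bounded_linear_diag_op)

lemma inner_shift_op: "inner (shift_op k x) y = inner x (shift_op (- k) y)"
proof transfer
  fix k :: int and f g :: "int \<Rightarrow> complex"
  show "(\<Sum>\<^sub>\<infinity>n. inner (f (n + k)) (g n)) = (\<Sum>\<^sub>\<infinity>n. inner (f n :: complex) (g (n + - k)))"
    using infsum_reindex_bij_betw[OF bij_shift, of "\<lambda>n. inner (f n) (g (n - k))" k] by simp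
qed

lemma inner_diag_op: "inner (diag_op V \<omega> z x) y = inner x (diag_op V \<omega> (cnj z) y)"
  by transfer (simp add: inner_complex_def algebra_simps)

lemma inner_fib_op: "inner (fib_op V \<omega> z x) y = inner x (fib_op V \<omega> (cnj z) y)"
  using inner_shift_op[of 1 x y] inner_shift_op[of "-1" x y]
  by (simp add: fib_op_def inner_add_left inner_add_right inner_diag_op)

lemma fib_op_commute: "fib_op V \<omega> z (fib_op V \<omega> z' x) = fib_op V \<omega> z' (fib_op V \<omega> z x)"
  unfolding coords_inject[symmetric] coords_fib_op
  by (rule ext) (simp add: fib_hamiltonian_def algebra_simps)

text \<open>\<open>bounded_linear\<close> covers real scalars; complex homogeneity of the inverse,
  demanded by \<open>bounded_op\<close>, comes from here.\<close>

lemma fib_op_cmult: "fib_op V \<omega> z (cmult_op c x) = cmult_op c (fib_op V \<omega> z x)"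
  unfolding coords_inject[symmetric] coords_fib_op cmult_op.rep_eq
  by (rule ext) (simp add: fib_hamiltonian_def algebra_simps)

text \<open>The lower bound gives injectivity and an inverse of norm at most 1/\<epsilon>; normality
  of H - z supplies surjectivity.\<close>

lemma not_in_spectrum:
  assumes \<epsilon>: "0 < \<epsilon>" and below: "\<And>x. \<epsilon> * norm x \<le> norm (fib_op V \<omega> z x)"
  shows "z \<notin> spectrum (fib_hamiltonian V \<omega>)"
proof -
  let ?T = "fib_op V \<omega> z"
  interpret T: bounded_linear ?T by (rule bounded_linear_fib_op)
  have "\<exists>x. ?T x = y" for y
    by (rule normal_bounded_below_surj[OF bounded_linear_fib_op bounded_linear_fib_op inner_fib_op fib_op_commute \<epsilon> below])
  then have surj: "?T (inv ?T y) = y" for y by (metis surj_def surj_f_inv_f)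
  have inj: "x = y" if "?T x = ?T y" for x y
  proof -
    have "\<epsilon> * norm (x - y) \<le> 0" using below[of "x - y"] that by (simp add: T.diff)
    then have "norm (x - y) \<le> 0" using \<epsilon> by (simp add: mult_le_0_iff)
    then show ?thesis by simp
  qed
  have invT: "inv ?T (?T x) = x" for x by (rule inj) (rule surj)
  define R where "R = (\<lambda>\<phi>. coords (inv ?T (Ell2 \<phi>)))"
  have Ell2_add: "Ell2 (\<lambda>n. \<phi> n + \<psi> n) = Ell2 \<phi> + Ell2 \<psi>" if "\<phi> \<in> l2" "\<psi> \<in> l2" for \<phi> \<psi>
    using that by (simp add: coords_inject[symmetric] plus_ell2.rep_eq Ell2_inverse l2_add)
  have Ell2_cmult: "Ell2 (\<lambda>n. c * \<psi> n) = cmult_op c (Ell2 \<psi>)" if "\<psi> \<in> l2" for c \<psi>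
    using that by (simp add: coords_inject[symmetric] cmult_op.rep_eq Ell2_inverse l2_cmult)
  have HE: "(\<lambda>n. fib_hamiltonian V \<omega> \<psi> n - z * \<psi> n) = coords (?T (Ell2 \<psi>))" if "\<psi> \<in> l2" for \<psi>
    using that by (simp add: coords_fib_op Ell2_inverse)
  have "bounded_op R"
    unfolding bounded_op_def
  proof (intro conjI ballI allI)
    fix \<phi> \<psi> c assume \<psi>: "\<psi> \<in> l2"
    show "R \<psi> \<in> l2" by (simp add: R_def coords_l2)
    show "R (\<lambda>n. \<phi> n + \<psi> n) = (\<lambda>n. R \<phi> n + R \<psi> n)" if "\<phi> \<in> l2"
    proof -
      have "inv ?T (Ell2 \<phi> + Ell2 \<psi>) = inv ?T (Ell2 \<phi>) + inv ?T (Ell2 \<psi>)"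
        by (rule inj) (simp add: surj T.add)
      then show ?thesis using that \<psi> by (simp add: R_def Ell2_add plus_ell2.rep_eq)
    qed
    show "R (\<lambda>n. c * \<psi> n) = (\<lambda>n. c * R \<psi> n)"
    proof -
      have "inv ?T (cmult_op c (Ell2 \<psi>)) = cmult_op c (inv ?T (Ell2 \<psi>))"
        by (rule inj) (simp add: surj fib_op_cmult)
      then show ?thesis using \<psi> by (simp add: R_def Ell2_cmult cmult_op.rep_eq)
    qed
  next
    show "\<exists>K. \<forall>\<psi>\<in>l2. l2_norm (R \<psi>) \<le> K * l2_norm \<psi>"
    proof (intro exI ballI)
      fix \<psi> assume "\<psi> \<in> l2"
      then have "l2_norm \<psi> = norm (Ell2 \<psi>)" using l2_norm_coords[of "Ell2 \<psi>"] by (simp add: Ell2_inverse)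
      then show "l2_norm (R \<psi>) \<le> (1 / \<epsilon>) * l2_norm \<psi>"
        using below[of "inv ?T (Ell2 \<psi>)"] \<epsilon> by (simp add: R_def l2_norm_coords surj field_simps)
    qed
  qed
  moreover have "R (\<lambda>n. fib_hamiltonian V \<omega> \<psi> n - z * \<psi> n) = \<psi>" if "\<psi> \<in> l2" for \<psi>
    using that unfolding HE[OF that] by (simp add: R_def coords_inverse invT Ell2_inverse)
  moreover have "(\<lambda>n. fib_hamiltonian V \<omega> (R \<psi>) n - z * R \<psi> n) = \<psi>" if "\<psi> \<in> l2" for \<psi>
    using HE[of "R \<psi>"] that by (simp add: R_def coords_inverse coords_l2 surj Ell2_inverse)
  ultimately show ?thesis unfolding spectrum_def by blast
qed

section \<open>Finitely supported approximate eigenvectors\<close>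

lift_definition trunc_op :: "nat \<Rightarrow> ell2 \<Rightarrow> ell2" is "\<lambda>N f n. if \<bar>n\<bar> \<le> int N then f n else 0"
proof -
  fix N :: nat and f :: "int \<Rightarrow> complex" assume "f \<in> l2"
  from l2_mult_bounded[OF this, of "\<lambda>n. if \<bar>n\<bar> \<le> int N then 1 else 0" 1]
  show "(\<lambda>n. if \<bar>n\<bar> \<le> int N then f n else 0) \<in> l2" by (simp add: if_distrib[of "\<lambda>c. c * _"] cong: if_cong)
qed

lemma norm_ell2_sq_finite:
  assumes "finite X" "\<And>n. n \<notin> X \<Longrightarrow> coords x n = 0"
  shows "(norm x)\<^sup>2 = (\<Sum>n\<in>X. (norm (coords x n))\<^sup>2)"
proof -
  have "(\<Sum>\<^sub>\<infinity>n. (norm (coords x n))\<^sup>2) = (\<Sum>\<^sub>\<infinity>n\<in>X. (norm (coords x n))\<^sup>2)"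
    using assms by (intro infsum_cong_neutral) auto
  then show ?thesis using assms by (simp add: norm_ell2_sq)
qed

text \<open>Truncation and remainder have disjoint supports, so their squared norms add up, and the
  remainder is at most what a large finite partial sum misses.\<close>

lemma trunc_op_tendsto: "(\<lambda>N. trunc_op N x) \<longlonglongrightarrow> x"
proof (rule metric_LIMSEQ_I)
  fix r :: real assume r: "0 < r"
  let ?g = "\<lambda>n. (norm (coords x n))\<^sup>2"
  have sg: "?g summable_on UNIV" using coords_l2[of x] by (simp add: l2_def)
  have split: "(norm x)\<^sup>2 = (norm (trunc_op N x))\<^sup>2 + (norm (x - trunc_op N x))\<^sup>2" for N
  proof -
    have "(norm (trunc_op N x))\<^sup>2 + (norm (x - trunc_op N x))\<^sup>2
      = (\<Sum>\<^sub>\<infinity>n. (norm (coords (trunc_op N x) n))\<^sup>2 + (norm (coords (x - trunc_op N x) n))\<^sup>2)"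
      unfolding norm_ell2_sq using coords_l2 by (intro infsum_add[symmetric]) (auto simp: l2_def)
    also have "\<dots> = (\<Sum>\<^sub>\<infinity>n. ?g n)"
      by (intro infsum_cong) (simp add: trunc_op.rep_eq minus_ell2.rep_eq)
    finally show ?thesis by (simp add: norm_ell2_sq)
  qed
  have "0 < (r / 2)\<^sup>2" using r by simp
  from infsum_finite_approximation[OF sg this] obtain F where F: "finite F" "dist (sum ?g F) (infsum ?g UNIV) \<le> (r / 2)\<^sup>2"
    by blast
  \<comment> \<open>The sum of all absolute values bounds each element of \<open>F\<close>.\<close>
  define N0 where "N0 = nat (\<Sum>n\<in>F. \<bar>n\<bar>)"
  have "dist (trunc_op N x) x < r" if N: "N0 \<le> N" for N
  proof -
    have "n \<in> {- int N..int N}" if "n \<in> F" for n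
    proof -
      have "\<bar>n\<bar> \<le> (\<Sum>n\<in>F. \<bar>n\<bar>)" using member_le_sum[of n F "\<lambda>n. \<bar>n\<bar>"] that F by simp
      also have "\<dots> \<le> int N" using N by (simp add: N0_def)
      finally show ?thesis by auto
    qed
    then have "sum ?g F \<le> (\<Sum>n\<in>{- int N..int N}. ?g n)" by (intro sum_mono2) auto
    also have "\<dots> = (norm (trunc_op N x))\<^sup>2"
      by (subst norm_ell2_sq_finite[of "{- int N..int N}"]) (auto simp: trunc_op.rep_eq intro!: sum.cong)
    finally have "(norm (x - trunc_op N x))\<^sup>2 \<le> (norm x)\<^sup>2 - sum ?g F" using split[of N] by linarith
    also have "\<dots> \<le> (r / 2)\<^sup>2" using F(2) by (simp add: norm_ell2_sq dist_real_def)
    finally have "norm (x - trunc_op N x) \<le> r / 2" by (rule power2_le_imp_le) (use r in simp)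
    then show ?thesis using r by (simp add: dist_norm norm_minus_commute)
  qed
  then show "\<exists>no. \<forall>n\<ge>no. dist (trunc_op n x) x < r" by blast
qed

text \<open>A spectral value admits a vector violating the lower bound; the violation is a strict
  inequality between continuous quantities and survives truncation.\<close>

lemma spectrum_approx:
  assumes "z \<in> spectrum (fib_hamiltonian V \<omega>)" "0 < \<epsilon>"
  obtains N x where "\<And>n. int N < \<bar>n\<bar> \<Longrightarrow> coords x n = 0" "norm (fib_op V \<omega> z x) < \<epsilon> * norm x"
proof -
  obtain x where x: "norm (fib_op V \<omega> z x) < \<epsilon> * norm x"
    using not_in_spectrum[OF assms(2)] assms(1) by (metis not_le)
  have "(\<lambda>N. \<epsilon> * norm (trunc_op N x) - norm (fib_op V \<omega> z (trunc_op N x)))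
      \<longlonglongrightarrow> \<epsilon> * norm x - norm (fib_op V \<omega> z x)"
    by (intro tendsto_intros bounded_linear.tendsto[OF bounded_linear_fib_op] trunc_op_tendsto)
  then have "\<forall>\<^sub>F N in sequentially. 0 < \<epsilon> * norm (trunc_op N x) - norm (fib_op V \<omega> z (trunc_op N x))"
    by (rule order_tendstoD) (use x in simp)
  then obtain N where "0 < \<epsilon> * norm (trunc_op N x) - norm (fib_op V \<omega> z (trunc_op N x))"
    by (auto simp: eventually_sequentially)
  then show ?thesis by (intro that[of N "trunc_op N x"]) (auto simp: trunc_op.rep_eq)
qed

text \<open>A cyclic \<open>p\<close>-site Schroedinger matrix with sites \<open>a + 1, \<dots>, a + p\<close>.\<close>

definition ring_next :: "int \<Rightarrow> nat \<Rightarrow> int \<Rightarrow> int" where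
  "ring_next a p i = (if i = a + int p then a + 1 else i + 1)"

definition ring_prev :: "int \<Rightarrow> nat \<Rightarrow> int \<Rightarrow> int" where
  "ring_prev a p i = (if i = a + 1 then a + int p else i - 1)"

definition ring_matrix :: "int \<Rightarrow> nat \<Rightarrow> (int \<Rightarrow> real) \<Rightarrow> int \<Rightarrow> int \<Rightarrow> real" where
  "ring_matrix a p v i j = (if j = ring_next a p i then 1 else 0) + (if i = ring_next a p j then 1 else 0)
     + (if i = j then v i else 0)"

lemma ring_matrix_sym: "ring_matrix a p v i j = ring_matrix a p v j i"
  by (auto simp: ring_matrix_def)

lemma ring_matrix_apply:
  fixes f :: "int \<Rightarrow> 'b :: real_normed_field"
  assumes "i \<in> {a + 1..a + int p}"
  shows "(\<Sum>j\<in>{a + 1..a + int p}. of_real (ring_matrix a p v i j) * f j)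
    = f (ring_next a p i) + f (ring_prev a p i) + of_real (v i) * f i"
proof -
  have prev: "i = ring_next a p j \<longleftrightarrow> j = ring_prev a p i" if "j \<in> {a + 1..a + int p}" for j
    using that assms by (auto simp: ring_next_def ring_prev_def)
  have "(\<Sum>j\<in>{a + 1..a + int p}. of_real (ring_matrix a p v i j) * f j)
    = (\<Sum>j\<in>{a + 1..a + int p}. (if j = ring_next a p i then f j else 0)
        + (if j = ring_prev a p i then f j else 0) + (if i = j then of_real (v i) * f j else 0))"
    by (intro sum.cong refl) (simp add: ring_matrix_def prev distrib_right if_distrib[of of_real]
        if_distrib[of "\<lambda>x. x * f _"] cong: if_cong)
  also have "\<dots> = f (ring_next a p i) + f (ring_prev a p i) + of_real (v i) * f i"
    using assms by (simp add: sum.distrib) (auto simp: ring_next_def ring_prev_def)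
  finally show ?thesis .
qed

text \<open>The periodic extension of an eigenvector of the ring is fixed by the monodromy matrix, and a
  matrix of determinant \<open>1\<close> with eigenvalue \<open>1\<close> has trace \<open>2\<close>.\<close>

lemma ring_eigenvalue_trace:
  assumes "0 < p" and w: "\<exists>i\<in>{a + 1..a + int p}. w i \<noteq> 0"
    and eig: "\<And>i. i \<in> {a + 1..a + int p} \<Longrightarrow>
      (\<Sum>j\<in>{a + 1..a + int p}. ring_matrix a p v i j * w j) = lam * w i"
  shows "trace (transfer (\<lambda>n. lam - v n) (a + 1) p) = 2"
proof -
  \<comment> \<open>\<open>r\<close> maps a site to its representative on the ring, so
    \<open>W\<close> is the periodic extension of the eigenvector and solves the equation on all
    integers.\<close>
  define r where "r = (\<lambda>n. a + 1 + (n - a - 1) mod int p)"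
  define W where "W = (\<lambda>n. w (r n))"
  define c where "c = (\<lambda>n. lam - v (r n))"
  have r_in: "r n \<in> {a + 1..a + int p}" for n
  proof -
    have "0 \<le> (n - a - 1) mod int p" "(n - a - 1) mod int p < int p" using assms(1) by simp_all
    then show ?thesis unfolding r_def atLeastAtMost_iff by linarith
  qed
  have r_id: "r n = n" if "n \<in> {a + 1..a + int p}" for n
    using that by (simp add: r_def mod_pos_pos_trivial)
  have r_next: "r (n + 1) = ring_next a p (r n)" for n
  proof -
    define m where "m = (n - a - 1) mod int p"
    have m: "0 \<le> m" "m < int p" using assms(1) by (simp_all add: m_def)
    have "(n + 1 - a - 1) mod int p = (m + 1) mod int p"
      by (simp add: m_def mod_simps algebra_simps)
    also have "\<dots> = (if m + 1 = int p then 0 else m + 1)"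
      using m by (auto simp: mod_pos_pos_trivial)
    finally show ?thesis by (simp add: r_def ring_next_def m_def[symmetric])
  qed
  have r_prev: "r (n - 1) = ring_prev a p (r n)" for n
  proof -
    have "r n = ring_next a p (r (n - 1))" using r_next[of "n - 1"] by simp
    then show ?thesis using r_in[of n] r_in[of "n - 1"]
      by (auto simp: ring_next_def ring_prev_def split: if_splits)
  qed
  have rec: "W (n + 1) + W (n - 1) = c n * W n" for n
    using eig[OF r_in[of n]] ring_matrix_apply[OF r_in[of n], of v w]
    unfolding W_def c_def r_next r_prev by (simp add: algebra_simps)
  have "W (a + 1 + int p) = W (a + 1)" "W (a + int p) = W a"
    by (simp_all add: W_def r_def)
  moreover have "transfer c (a + 1) p = transfer (\<lambda>n. lam - v n) (a + 1) p"
    by (rule transfer_cong) (simp add: c_def r_id)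
  ultimately have fix1: "transfer (\<lambda>n. lam - v n) (a + 1) p *v vector [W (a + 1), W a] = vector [W (a + 1), W a]"
    using transfer_solution[of W c "a + 1" p, OF rec] by simp
  let ?A = "transfer (\<lambda>n. lam - v n) (a + 1) p" and ?x = "vector [W (a + 1), W a] :: real^2"
  have "?x = (?A ** ?A) *v ?x" by (simp add: fix1 flip: matrix_vector_mul_assoc)
  also have "\<dots> = trace ?A *\<^sub>R ?x - ?x"
    unfolding Cayley_Hamilton_2[of ?A] det_transfer
    by (simp add: matrix_vector_mult_diff_rdistrib fix1 flip: scaleR_matrix_vector_assoc)
  finally have "(trace ?A - 2) *\<^sub>R ?x = 0" by (simp add: algebra_simps scaleR_2)
  \<comment> \<open>Two neighbouring zeros would propagate to every site of the ring.\<close>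
  moreover have "?x \<noteq> 0"
  proof
    assume x0: "?x = 0"
    from w obtain i where i: "i \<in> {a + 1..a + int p}" "w i \<noteq> 0" by blast
    define m where "m = nat (i - (a + 1))"
    have "vector [W (a + 1 + int m), W (a + 1 + int m - 1)] = (0 :: real^2)"
      using transfer_solution[of W c "a + 1" m, OF rec] x0 by simp
    then have "W (a + 1 + int m) = 0" by (metis vector_2(1) zero_index)
    then show False using i r_id[of i] by (simp add: W_def m_def)
  qed
  ultimately show ?thesis by simp
qed

lemma spectrum_periodic_approx:
  assumes z: "z \<in> spectrum (fib_hamiltonian V \<omega>)" and \<epsilon>: "0 < \<epsilon>"
  obtains j lam where "n0 \<le> j" "\<bar>Im z\<bar> \<le> \<epsilon>" "\<bar>lam - Re z\<bar> \<le> \<epsilon>" "fib_trace lam V j = 2"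
proof -
  obtain N x where x: "\<And>n. int N < \<bar>n\<bar> \<Longrightarrow> coords x n = 0"
    and small: "norm (fib_op V \<omega> z x) < \<epsilon> * norm x" using spectrum_approx[OF z \<epsilon>] by blast
  have fib_unbounded: "n \<le> fib (n + 5)" for n
  proof (induction n)
    case (Suc n)
    have "fib (Suc n + 5) = fib (n + 5) + fib (n + 4)" using fib_plus_2[of "n + 4"] by (simp add: eval_nat_numeral)
    moreover have "0 < fib (n + 4)" by (rule fib_neq_0_nat) simp
    ultimately show ?case using Suc by linarith
  qed simp
  \<comment> \<open>The ring starts at a + 1 = -N - 1 and has at least 2 N + 4 sites, a length that
    \<open>fib_unbounded\<close> guarantees from index 2 N + 9 on. It thus contains the support of H
    x, and its closing bond meets only zeros of x.\<close>
  define k where "k = max n0 (2 * N + 9)"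
  define a where "a = - int N - 2"
  have "1 \<le> k" by (simp add: k_def)
  from no_mismatch_right[OF this, of a \<omega>] obtain j where j: "k \<le> j" "\<And>i. a \<le> i \<Longrightarrow> i < a + int (fib j) \<Longrightarrow> \<not> mismatch \<omega> j i"
    by blast
  define p where "p = fib j"
  have "2 * N + 4 \<le> fib ((2 * N + 4) + 5)" by (rule fib_unbounded)
  also have "\<dots> \<le> p" unfolding p_def by (rule fib_mono) (use j(1) in \<open>simp add: k_def\<close>)
  finally have p: "2 * N + 4 \<le> p" .
  let ?X = "{a + 1..a + int p}" and ?v = "fib_potential V \<omega>" and ?f = "coords x"
  have out: "?f i = 0" if "i < - int N \<or> int N < i" for i using x[of i] that by auto
  have H: "(\<Sum>j\<in>?X. of_real (ring_matrix a p ?v i j) * ?f j) - z * ?f i = coords (fib_op V \<omega> z x) i"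
    if "i \<in> ?X" for i
  proof -
    have "?f (ring_next a p i) = ?f (i + 1)"
      using p by (auto simp: ring_next_def a_def out)
    moreover have "?f (ring_prev a p i) = ?f (i - 1)"
      using p by (auto simp: ring_prev_def a_def out)
    ultimately show ?thesis unfolding ring_matrix_apply[OF that] coords_fib_op fib_hamiltonian_def by simp
  qed
  have "coords (fib_op V \<omega> z x) i = 0" if "i \<notin> ?X" for i
    using that p unfolding coords_fib_op fib_hamiltonian_def by (auto simp: a_def out)
  then have n1: "(norm (fib_op V \<omega> z x))\<^sup>2 = (\<Sum>i\<in>?X. (norm (coords (fib_op V \<omega> z x) i))\<^sup>2)"
    by (intro norm_ell2_sq_finite) auto
  have n2: "(norm x)\<^sup>2 = (\<Sum>i\<in>?X. (norm (?f i))\<^sup>2)"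
    using p by (intro norm_ell2_sq_finite) (auto simp: a_def out)
  have "(norm (fib_op V \<omega> z x))\<^sup>2 < (\<epsilon> * norm x)\<^sup>2"
    using small by (intro power_strict_mono) auto
  then have "(\<Sum>i\<in>?X. (norm ((\<Sum>j\<in>?X. of_real (ring_matrix a p ?v i j) * ?f j) - z * ?f i))\<^sup>2)
      < \<epsilon>\<^sup>2 * (\<Sum>i\<in>?X. (norm (?f i))\<^sup>2)"
    unfolding power_mult_distrib n1 n2 using H by simp
  from symmetric_eigenvalue_near[OF _ ring_matrix_sym \<epsilon> this]
  obtain lam w where lam: "\<bar>Im z\<bar> \<le> \<epsilon>" "\<bar>lam - Re z\<bar> \<le> \<epsilon>" "\<exists>i\<in>?X. w i \<noteq> 0"
    "\<And>i. i \<in> ?X \<Longrightarrow> (\<Sum>j\<in>?X. ring_matrix a p ?v i j * w j) = lam * w i"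
    by auto
  have "trace (transfer (\<lambda>n. lam - ?v n) (a + 1) p) = 2"
    using p by (intro ring_eigenvalue_trace[OF _ lam(3,4)]) auto
  moreover have "trace (transfer (\<lambda>n. lam - ?v n) (a + 1) p) = fib_trace lam V j"
    unfolding p_def by (rule trace_transfer_period) (use j in \<open>auto simp: k_def\<close>)
  ultimately show ?thesis using that[of j lam] lam j by (simp add: k_def)
qed

section \<open>Traces at spectral energies\<close>

lemma continuous_fib_trace: "continuous_on UNIV (\<lambda>E. fib_trace E V k)"
proof -
  have "continuous_on UNIV (\<lambda>E. fib_trace E V k) \<and> continuous_on UNIV (\<lambda>E. fib_trace E V (Suc k))
    \<and> continuous_on UNIV (\<lambda>E. fib_trace E V (Suc (Suc k)))"
  proof (induction k)
    case 0
    have "fib_trace E V (Suc 0) = E" "fib_trace E V (Suc (Suc 0)) = E - V" for E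
      using fib_trace_initial(2,3)[of E V] unfolding numeral_2_eq_2 One_nat_def .
    then show ?case by (auto simp: fib_trace_initial intro!: continuous_intros)
  next
    case (Suc k)
    then show ?case unfolding fib_trace_rec by (auto intro!: continuous_intros)
  qed
  then show ?thesis by blast
qed

text \<open>Two consecutive traces above 2 in modulus at Re z would stay so at nearby energies,
  among them an energy where a later trace equals 2. This contradicts
  \<open>fib_trace_escape'\<close>.\<close>

lemma spectrum_real_trace_bound:
  assumes "0 \<le> V" "z \<in> spectrum (fib_hamiltonian V \<omega>)"
  shows "z = of_real (Re z)" "\<bar>fib_trace (Re z) V k\<bar> \<le> 2 + V"
proof -
  have "\<bar>Im z\<bar> \<le> 0 + e" if "0 < e" for e using spectrum_periodic_approx[OF assms(2) that] by (metis add_0)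
  then have "\<bar>Im z\<bar> \<le> 0" by (rule field_le_epsilon)
  then show "z = of_real (Re z)" by (simp add: complex_eq_iff)
  have "\<bar>fib_trace (Re z) V n\<bar> \<le> 2 \<or> \<bar>fib_trace (Re z) V (Suc n)\<bar> \<le> 2" for n
  proof (rule ccontr)
    assume "\<not> ?thesis"
    then have gt: "2 < \<bar>fib_trace (Re z) V n\<bar>" "2 < \<bar>fib_trace (Re z) V (Suc n)\<bar>" by auto
    have ev: "\<forall>\<^sub>F E in at (Re z). 2 < \<bar>fib_trace E V m\<bar>" if "2 < \<bar>fib_trace (Re z) V m\<bar>" for m
    proof -
      have "isCont (\<lambda>E. fib_trace E V m) (Re z)"
        using continuous_fib_trace continuous_on_eq_continuous_at[OF open_UNIV] by blast
      then have "((\<lambda>E. \<bar>fib_trace E V m\<bar>) \<longlongrightarrow> \<bar>fib_trace (Re z) V m\<bar>) (at (Re z))"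
        unfolding isCont_def by (rule tendsto_rabs)
      then show ?thesis using that by (rule order_tendstoD)
    qed
    from eventually_conj[OF ev[OF gt(1)] ev[OF gt(2)]]
    obtain d where d: "0 < d" "\<And>E. E \<noteq> Re z \<Longrightarrow> dist E (Re z) < d \<Longrightarrow>
        2 < \<bar>fib_trace E V n\<bar> \<and> 2 < \<bar>fib_trace E V (Suc n)\<bar>"
      unfolding eventually_at by blast
    have "0 < d / 2" using d(1) by simp
    from spectrum_periodic_approx[OF assms(2) this, of n]
    obtain j lam where j: "n \<le> j" "\<bar>lam - Re z\<bar> \<le> d / 2" "fib_trace lam V j = 2" by blast
    have "2 < \<bar>fib_trace lam V n\<bar> \<and> 2 < \<bar>fib_trace lam V (Suc n)\<bar>"
    proof (cases "lam = Re z")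
      case False
      then show ?thesis using d j by (auto simp: dist_real_def)
    qed (use gt in auto)
    then show False using fib_trace_escape'[of lam V n j] j by simp
  qed
  then show "\<bar>fib_trace (Re z) V k\<bar> \<le> 2 + V" by (rule fib_trace_bound[OF assms(1)])
qed

section \<open>Power-law bounds\<close>

text \<open>A positive root satisfies a^2 = 2 + V + 1/a, and the intermediate value theorem on
  [0, 2 + V] shows that the largest root is positive.\<close>

lemma a_root_pos_sq:
  assumes "0 \<le> V"
  shows "0 < a_root V" "2 + V \<le> (a_root V)\<^sup>2"
proof -
  let ?R = "{x::real. x ^ 3 - (2 + V) * x - 1 = 0}"
  have "?R = {x. poly [:-1, -(2 + V), 0, 1:] x = 0}" by (auto simp: algebra_simps power3_eq_cube)
  then have fin: "finite ?R" by (simp only:) (rule poly_roots_finite, simp)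
  have "\<exists>x\<ge>0. x \<le> 2 + V \<and> x ^ 3 - (2 + V) * x - 1 = 0"
  proof (rule IVT')
    have "1 * 1 \<le> (2 + V)\<^sup>2 * (1 + V)" using assms by (intro mult_mono one_le_power) auto
    then show "0 \<le> (2 + V) ^ 3 - (2 + V) * (2 + V) - 1" by (simp add: power2_eq_square power3_eq_cube algebra_simps)
  qed (use assms in \<open>auto intro!: continuous_intros\<close>)
  then obtain x where x: "0 \<le> x" "x \<in> ?R" by auto
  then have "0 < x" by (cases "x = 0") auto
  have "a_root V \<in> ?R" unfolding a_root_def using fin x(2) by (intro Max_in) auto
  then have r: "a_root V * (a_root V)\<^sup>2 = (2 + V) * a_root V + 1"
    by (simp add: power2_eq_square power3_eq_cube)
  have "x \<le> a_root V" unfolding a_root_def using fin x(2) by (rule Max_ge)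
  then show pos: "0 < a_root V" using \<open>0 < x\<close> by simp
  have "a_root V * (2 + V) \<le> a_root V * (a_root V)\<^sup>2" unfolding r by (simp add: mult.commute)
  then show "2 + V \<le> (a_root V)\<^sup>2" using pos by simp
qed

section \<open>Golden powers and local norms\<close>

context
  fixes \<phi> :: real
  defines "\<phi> \<equiv> (sqrt 5 + 1) / 2"
begin

lemma golden_ratio: "1 < \<phi>" "\<phi> < 2" "\<phi>\<^sup>2 = \<phi> + 1"
proof -
  have "2 < sqrt (5::real)" by (rule real_less_rsqrt) simp
  moreover have "sqrt (5::real) < 3" by (rule real_less_lsqrt) simp_all
  ultimately show "1 < \<phi>" "\<phi> < 2" by (auto simp: \<phi>_def)
  have "sqrt 5 * sqrt 5 = (5::real)" by simp
  then show "\<phi>\<^sup>2 = \<phi> + 1" by (simp add: \<phi>_def power2_eq_square field_simps)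
qed

lemma golden_power_add: "\<phi> ^ Suc (Suc n) = \<phi> ^ Suc n + \<phi> ^ n"
proof -
  have "\<phi> ^ Suc (Suc n) = \<phi>\<^sup>2 * \<phi> ^ n" by (simp add: power2_eq_square)
  then show ?thesis unfolding golden_ratio(3) by (simp add: algebra_simps)
qed

lemma fib_le_golden_power: "real (fib (Suc n)) \<le> \<phi> ^ n"
proof (induction n rule: fib.induct)
  case (3 n)
  show ?case using 3 unfolding golden_power_add fib.simps(3)[of "Suc n"] by simp
qed (use golden_ratio in auto)

lemma golden_power_le_fib: "\<phi> ^ n \<le> real (fib (Suc (Suc n)))"
proof (induction n rule: fib.induct)
  case (3 n)
  show ?case using 3 unfolding golden_power_add fib.simps(3)[of "Suc (Suc n)"] by simp
qed (use golden_ratio in auto)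

lemma local_norm_sq:
  "(local_norm u L)\<^sup>2 = (\<Sum>n = 1..\<lfloor>L\<rfloor>. (norm (u n))\<^sup>2) + (L - of_int \<lfloor>L\<rfloor>) * (norm (u (\<lfloor>L\<rfloor> + 1)))\<^sup>2"
  unfolding local_norm_def by (simp add: sum_nonneg)

lemma local_norm_nonneg: "0 \<le> local_norm u L"
  unfolding local_norm_def by (simp add: sum_nonneg)

lemma sum_le_local_norm_sq:
  assumes "m \<le> \<lfloor>L\<rfloor>"
  shows "(\<Sum>n = 1..m. (norm (u n))\<^sup>2) \<le> (local_norm u L)\<^sup>2"
proof -
  have "(\<Sum>n = 1..m. (norm (u n))\<^sup>2) \<le> (\<Sum>n = 1..\<lfloor>L\<rfloor>. (norm (u n))\<^sup>2)"
    using assms by (intro sum_mono2) auto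
  then show ?thesis unfolding local_norm_sq by (simp add: add_increasing2)
qed

text \<open>The square root of the number of sites is bounded by that number, a linear factor that
  becomes the summand 1 in the upper exponent.\<close>

lemma local_norm_le:
  fixes B L :: real
  assumes L: "1 \<le> L" and B: "\<And>n. \<bar>n\<bar> \<le> \<lfloor>L\<rfloor> + 1 \<Longrightarrow> norm (u n) \<le> B"
  shows "local_norm u L \<le> (\<lfloor>L\<rfloor> + 1) * B"
proof -
  let ?M = "\<lfloor>L\<rfloor> + 1"
  have M: "1 \<le> ?M" using L by simp
  have B0: "0 \<le> B" using B[of 0] M norm_ge_zero[of "u 0"] by linarith
  have "(local_norm u L)\<^sup>2 \<le> (\<Sum>n = 1..\<lfloor>L\<rfloor>. (norm (u n))\<^sup>2) + 1 * (norm (u ?M))\<^sup>2"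
    unfolding local_norm_sq by (intro add_left_mono mult_right_mono) (linarith, simp)
  also have "\<dots> \<le> (\<Sum>n = 1..\<lfloor>L\<rfloor>. B\<^sup>2) + 1 * B\<^sup>2"
    using B M by (intro add_mono sum_mono mult_left_mono power_mono) auto
  also have "\<dots> = real_of_int ?M * B\<^sup>2" using L by (simp add: algebra_simps)
  also have "\<dots> = 1 * real_of_int ?M * B\<^sup>2" by simp
  also have "\<dots> \<le> real_of_int ?M * real_of_int ?M * B\<^sup>2"
    using M by (intro mult_right_mono) auto
  also have "\<dots> = (real_of_int ?M * B)\<^sup>2" by (simp only: power2_eq_square mult_ac)
  finally show ?thesis by (rule power2_le_imp_le) (use M B0 in simp)
qed

context
  fixes V E \<omega> L :: real and u :: "int \<Rightarrow> complex"
  assumes V: "0 \<le> V" and tr: "\<And>k. \<bar>fib_trace E V k\<bar> \<le> 2 + V"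
    and u: "is_solution V \<omega> (of_real E) u" and nm: "(norm (u 0))\<^sup>2 + (norm (u 1))\<^sup>2 = 1"
    and L: "1 \<le> L"
begin

text \<open>With T = 2 + V each level costs (3 + V)^2, and about log L levels to base \<phi> are
  required. Rounding \<open>k\<close> up costs one more such factor, and [L] + 1 \<le> 2 L the power
  of 2.\<close>

lemma local_norm_upper:
  "local_norm u L \<le> 4 * (1 + (2 + V) + V) ^ 6 * (3 + V)\<^sup>2 * 2 powr (ln ((3 + V)\<^sup>2) / ln \<phi>)
    * L powr (1 + ln ((3 + V)\<^sup>2) / ln \<phi>)"
proof -
  let ?C = "(1 + (2 + V) + V) ^ 6" and ?D = "(3 + V)\<^sup>2" and ?M = "\<lfloor>L\<rfloor> + 1"
  define g where "g = ln ?D / ln \<phi>"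
  have D: "1 \<le> ?D" using V by (intro one_le_power) auto
  have D0: "3 + V \<noteq> 0" using V by simp
  have ph: "0 < ln \<phi>" using golden_ratio by simp
  have g0: "0 \<le> g" using D ph by (simp add: g_def)
  define m where "m = real_of_int ?M"
  have M: "1 \<le> m" "m \<le> 2 * L" unfolding m_def using L by linarith+
  define k where "k = nat \<lceil>log \<phi> m\<rceil>"
  have log0: "0 \<le> log \<phi> m" using M golden_ratio by simp
  then have k: "log \<phi> m \<le> real k" "real k \<le> log \<phi> m + 1" unfolding k_def by linarith+
  have "m = \<phi> powr (log \<phi> m)" using M golden_ratio by simp
  also have "\<dots> \<le> \<phi> powr real k" using k golden_ratio by (intro powr_mono) auto
  also have "\<dots> = \<phi> ^ k" using golden_ratio by (simp add: powr_realpow)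
  also have "\<dots> \<le> real (fib (Suc (Suc k)))" by (rule golden_power_le_fib)
  also have "\<dots> \<le> real (fib (k + 5))" using fib_mono[of "Suc (Suc k)" "k + 5"] by simp
  finally have Mk: "?M \<le> int (fib (k + 5))" unfolding m_def by linarith
  have "?D ^ k = ?D powr real k" by (rule powr_realpow[symmetric]) (use D in linarith)
  also have "\<dots> \<le> ?D powr (log \<phi> m + 1)" using k D by (intro powr_mono) auto
  also have "\<dots> = ?D powr (log \<phi> m) * ?D" using D by (simp add: powr_add)
  also have "?D powr (log \<phi> m) = m powr g"
    unfolding powr_def g_def log_def using M D0 by simp
  also have "m powr g * ?D \<le> (2 * L) powr g * ?D"
    using M g0 by (intro mult_right_mono powr_mono2) auto
  also have "(2 * L) powr g = 2 powr g * L powr g" using L by (simp add: powr_mult)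
  finally have Dk: "?D ^ k \<le> 2 powr g * L powr g * ?D" .
  have "norm (u n) \<le> ?C * ?D ^ k" if "\<bar>n\<bar> \<le> ?M" for n
    using bound_fib[OF V _ tr u nm, of n k] that Mk V by (simp add: add.assoc)
  then have "local_norm u L \<le> m * (?C * ?D ^ k)"
    unfolding m_def by (rule local_norm_le[OF L])
  also have "\<dots> \<le> (2 * L) * (?C * (2 powr g * L powr g * ?D))"
    using M Dk V L by (intro mult_mono) auto
  also have "\<dots> \<le> (4 * L) * (?C * (2 powr g * L powr g * ?D))"
    using V L by (intro mult_right_mono) auto
  also have "\<dots> = 4 * ?C * ?D * 2 powr g * (L powr 1 * L powr g)"
    using L by (simp add: mult_ac)
  finally show ?thesis unfolding g_def powr_add .
qed

text \<open>The squared norm gains a factor \<open>c\<close> per six levels, hence the 12. Dividing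
  by c^2 pays for rounding \<open>q\<close> down and for using \<open>mass_fib\<close> at q - 1. For
  L < 2, \<open>min 1 (L\<^sub>0 - 1)\<close> bounds the weight of site 2 from below.\<close>

lemma local_norm_lower:
  assumes L0: "1 < L\<^sub>0" "L\<^sub>0 \<le> L"
  defines "c \<equiv> 1 + 1 / ((2 + V)\<^sup>2 + 1)"
    and "d \<equiv> min 1 (L\<^sub>0 - 1) * (1 / (((2 + V) + V)\<^sup>2 + 2))"
  shows "sqrt (d / c\<^sup>2) * L powr (ln c / (12 * ln \<phi>)) \<le> local_norm u L"
proof -
  let ?c0 = "1 / (((2 + V) + V)\<^sup>2 + 2)"
  have ph: "0 < ln \<phi>" using golden_ratio by simp
  have c0: "0 \<le> ?c0" using zero_le_power2[of "2 + V + V"] by simp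
  have c: "1 \<le> c" using zero_le_power2[of "2 + V"] by (simp add: c_def)
  have d: "0 \<le> d" unfolding d_def using c0 L0 by (intro mult_nonneg_nonneg) auto
  have "min 1 (L\<^sub>0 - 1) * ?c0 \<le> 1 * ?c0" using c0 by (intro mult_right_mono) auto
  then have dc0: "d \<le> ?c0" by (simp only: d_def mult_1)
  define q where "q = nat \<lfloor>log \<phi> L / 6\<rfloor>"
  have log0: "0 \<le> log \<phi> L" using L golden_ratio by simp
  then have q: "real q \<le> log \<phi> L / 6" "log \<phi> L / 6 < real q + 1" unfolding q_def by linarith+
  have main: "d * c ^ q / c \<le> (local_norm u L)\<^sup>2"
  proof (cases q)
    case (Suc q')
    have e: "Suc (2 + 6 * q') = 3 + 6 * q'" by simp
    have "real (fib (3 + 6 * q')) \<le> \<phi> ^ (2 + 6 * q')"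
      using fib_le_golden_power[of "2 + 6 * q'"] unfolding e .
    also have "\<dots> \<le> \<phi> ^ (6 * q)" using Suc golden_ratio(1) by (intro power_increasing) auto
    also have "\<dots> = \<phi> powr real (6 * q)"
      by (rule powr_realpow[symmetric]) (use golden_ratio(1) in linarith)
    also have "\<dots> \<le> \<phi> powr (log \<phi> L)" using q golden_ratio(1) by (intro powr_mono) auto
    also have "\<dots> = L" using L golden_ratio(1) by simp
    finally have "int (fib (3 + 6 * q')) \<le> \<lfloor>L\<rfloor>" by (simp add: le_floor_iff)
    from sum_le_local_norm_sq[OF this, of u]
    have "c ^ q' * ?c0 \<le> (local_norm u L)\<^sup>2"
      using mass_fib[OF V _ tr u nm, of q'] V by (simp add: c_def)
    moreover have "d * c ^ q' \<le> ?c0 * c ^ q'" using dc0 c by (intro mult_right_mono) auto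
    moreover have "d * c ^ q / c = d * c ^ q'" using c Suc by simp
    ultimately show ?thesis by (simp only: mult.commute)
  next
    case 0
    have im: "?c0 \<le> (norm (u 1))\<^sup>2 + (norm (u 2))\<^sup>2"
      using initial_mass[OF V _ tr u nm] V by simp
    have "d \<le> (local_norm u L)\<^sup>2"
    proof (cases "2 \<le> L")
      case True
      then have "(\<Sum>n = 1..2. (norm (u n))\<^sup>2) \<le> (local_norm u L)\<^sup>2"
        by (intro sum_le_local_norm_sq) (simp add: le_floor_iff)
      moreover have "{1..2::int} = {1, 2}" by auto
      ultimately show ?thesis using im dc0 by simp
    next
      case False
      then have fl: "\<lfloor>L\<rfloor> = 1" using L by linarith
      have "d \<le> min 1 (L\<^sub>0 - 1) * ((norm (u 1))\<^sup>2 + (norm (u 2))\<^sup>2)"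
        unfolding d_def using im L0 by (intro mult_left_mono) auto
      also have "\<dots> \<le> 1 * (norm (u 1))\<^sup>2 + (L - 1) * (norm (u 2))\<^sup>2"
        unfolding distrib_left using L0 by (intro add_mono mult_right_mono) auto
      also have "\<dots> = (local_norm u L)\<^sup>2" unfolding local_norm_sq fl by simp
      finally show ?thesis .
    qed
    moreover have "d / c \<le> d" using c d by (simp add: divide_le_eq mult_le_cancel_left1)
    ultimately show ?thesis using 0 by simp
  qed
  have "c powr (log \<phi> L / 6) \<le> c powr (real q + 1)" using q c by (intro powr_mono) auto
  also have "\<dots> = c ^ q * c" using c by (simp add: powr_add powr_realpow)
  finally have "d * c powr (log \<phi> L / 6) / c\<^sup>2 \<le> d * (c ^ q * c) / c\<^sup>2"
    using d by (intro divide_right_mono mult_left_mono) auto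
  also have "\<dots> = d * c ^ q / c" using c by (simp add: power2_eq_square)
  also have "d * c powr (log \<phi> L / 6) / c\<^sup>2 = d / c\<^sup>2 * c powr (log \<phi> L / 6)" by simp
  also have "c powr (log \<phi> L / 6) = (L powr (ln c / (12 * ln \<phi>)))\<^sup>2"
  proof -
    define x where "x = ln c"
    define y where "y = ln L"
    have "log \<phi> L / 6 * x = (x / (12 * ln \<phi>) + x / (12 * ln \<phi>)) * y"
      using ph by (simp add: log_def y_def[symmetric] field_simps)
    then have "exp (log \<phi> L / 6 * ln c) = exp ((ln c / (12 * ln \<phi>) + ln c / (12 * ln \<phi>)) * ln L)"
      by (simp only: x_def y_def)
    then have "c powr (log \<phi> L / 6) = L powr (ln c / (12 * ln \<phi>) + ln c / (12 * ln \<phi>))"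
      using c L by (simp only: powr_def) simp
    then show ?thesis by (simp only: powr_add power2_eq_square)
  qed
  finally have "(sqrt (d / c\<^sup>2) * L powr (ln c / (12 * ln \<phi>)))\<^sup>2 \<le> (local_norm u L)\<^sup>2"
    unfolding power_mult_distrib using main d by simp
  then show ?thesis by (rule power2_le_imp_le[OF _ local_norm_nonneg])
qed

end

text \<open>For y = 1 / (1 + V)^2 the claim reduces to (1 + y/4)^3 \<le> (1 + y/5)^4, as (2 + V)^2 +
  1 \<le> 5 (1 + V)^2. The difference is a polynomial in y with nonnegative coefficients.\<close>

lemma lower_exponent_le:
  assumes "0 \<le> V"
  shows "ln (1 + 1 / (2 + 2 * V)\<^sup>2) / (16 * ln \<phi>) \<le> ln (1 + 1 / ((2 + V)\<^sup>2 + 1)) / (12 * ln \<phi>)"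
proof -
  have ph: "0 < ln \<phi>" using golden_ratio by simp
  define y where "y = 1 / (1 + V)\<^sup>2"
  have s: "1 \<le> (1 + V)\<^sup>2" using assms by (intro one_le_power) auto
  have y: "0 < y" using s by (auto simp: y_def intro: less_le_trans[OF zero_less_one])
  have "(2 + 2 * V)\<^sup>2 = 4 * (1 + V)\<^sup>2" by (simp add: power2_eq_square algebra_simps)
  then have e: "1 + 1 / (2 + 2 * V)\<^sup>2 = 1 + y / 4" by (simp add: y_def)
  have "(2 + V)\<^sup>2 + 1 \<le> 5 * (1 + V)\<^sup>2" using assms by (simp add: power2_eq_square algebra_simps)
  moreover have "0 < (2 + V)\<^sup>2 + 1" using zero_le_power2[of "2 + V"] by linarith
  ultimately have "1 / (5 * (1 + V)\<^sup>2) \<le> 1 / ((2 + V)\<^sup>2 + 1)" using s by (intro divide_left_mono mult_pos_pos) auto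
  then have c: "1 + y / 5 \<le> 1 + 1 / ((2 + V)\<^sup>2 + 1)" by (simp add: y_def)
  have "(1 + y / 4) ^ 3 \<le> (1 + y / 5) ^ 4"
  proof -
    have "0 \<le> y / 20 + 21 * y\<^sup>2 / 400 + 131 * y ^ 3 / 8000 + y ^ 4 / 625" using y by simp
    also have "\<dots> = (1 + y / 5) ^ 4 - (1 + y / 4) ^ 3" by (simp add: field_simps eval_nat_numeral)
    finally show ?thesis by simp
  qed
  also have "\<dots> \<le> (1 + 1 / ((2 + V)\<^sup>2 + 1)) ^ 4" using c y by (intro power_mono) auto
  finally have "ln ((1 + y / 4) ^ 3) \<le> ln ((1 + 1 / ((2 + V)\<^sup>2 + 1)) ^ 4)"
    using y by (subst ln_le_cancel_iff) (auto intro!: zero_less_power add_pos_pos less_le_trans[OF _ c])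
  then have "3 * ln (1 + y / 4) \<le> 4 * ln (1 + 1 / ((2 + V)\<^sup>2 + 1))"
    using y c by (simp add: ln_realpow)
  then show ?thesis unfolding e using ph by (simp add: field_simps)
qed

text \<open>From (3 + V)^2 \<le> (5 + 2 V)(2 + V) and 2 + V \<le> a^2 one gets 3 + V \<le> sqrt (5 +
  2 V) a.\<close>

lemma upper_exponent_le:
  assumes "0 \<le> V"
  shows "ln ((3 + V)\<^sup>2) / ln \<phi> \<le> ln (sqrt (5 + 2 * V) * (3 + V) * a_root V) / ln \<phi>"
proof -
  note a = a_root_pos_sq[OF assms]
  have ph: "0 < ln \<phi>" using golden_ratio by simp
  have "(3 + V)\<^sup>2 \<le> (5 + 2 * V) * (2 + V)"
    using assms by (simp add: power2_eq_square algebra_simps)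
  also have "\<dots> \<le> (5 + 2 * V) * (a_root V)\<^sup>2" using assms a by (intro mult_left_mono) auto
  also have "\<dots> = (sqrt (5 + 2 * V) * a_root V)\<^sup>2" using assms by (simp add: power_mult_distrib)
  finally have "3 + V \<le> sqrt (5 + 2 * V) * a_root V"
    by (rule power2_le_imp_le) (use assms a in auto)
  then have "(3 + V) * (3 + V) \<le> (3 + V) * (sqrt (5 + 2 * V) * a_root V)"
    using assms by (intro mult_left_mono) auto
  then have "(3 + V)\<^sup>2 \<le> sqrt (5 + 2 * V) * (3 + V) * a_root V"
    by (simp add: power2_eq_square mult_ac)
  then show ?thesis using assms ph by (intro divide_right_mono ln_mono) auto
qed

end

theorem theorem5p2:
  fixes V \<gamma>\<^sub>l \<gamma>\<^sub>u L\<^sub>0 :: real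
  assumes "V > 0"
    and "\<gamma>\<^sub>l < ln (1 + 1 / (2 + 2 * V)\<^sup>2) / (16 * ln ((sqrt 5 + 1) / 2))"
    and "\<gamma>\<^sub>u > 1 + ln (sqrt (5 + 2 * V) * (3 + V) * a_root V) / ln ((sqrt 5 + 1) / 2)"
    and "L\<^sub>0 > 1"
  shows "\<exists>C\<^sub>l>0. \<exists>C\<^sub>u>0. \<forall>\<omega>::real. \<forall>L\<ge>1. \<forall>E\<in>fib_spectrum V. \<forall>u.
           is_solution V \<omega> E u \<and> (norm (u 0))\<^sup>2 + (norm (u 1))\<^sup>2 = 1 \<longrightarrow>
             (L \<ge> L\<^sub>0 \<longrightarrow> C\<^sub>l * L powr \<gamma>\<^sub>l \<le> local_norm u L) \<and>
             local_norm u L \<le> C\<^sub>u * L powr \<gamma>\<^sub>u"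
proof -
  let ?ph = "(sqrt 5 + 1) / 2 :: real"
  have V: "0 \<le> V" using assms(1) by simp
  define c where "c = 1 + 1 / ((2 + V)\<^sup>2 + 1)"
  define d where "d = min 1 (L\<^sub>0 - 1) * (1 / (((2 + V) + V)\<^sup>2 + 2))"
  define Cl where "Cl = sqrt (d / c\<^sup>2)"
  define Cu where "Cu = 4 * (1 + (2 + V) + V) ^ 6 * (3 + V)\<^sup>2 * 2 powr (ln ((3 + V)\<^sup>2) / ln ?ph)"
  have "0 < ((2 + V) + V)\<^sup>2 + 2" using zero_le_power2[of "2 + V + V"] by linarith
  then have "0 < d" using assms(4) by (simp add: d_def)
  moreover have "0 \<le> 1 / ((2 + V)\<^sup>2 + 1)" using zero_le_power2[of "2 + V"] by simp
  then have "0 < c" unfolding c_def by linarith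
  ultimately have Cl: "0 < Cl" by (simp add: Cl_def)
  have Cu: "0 < Cu" using V by (simp add: Cu_def)
  have gl: "\<gamma>\<^sub>l \<le> ln c / (12 * ln ?ph)" using assms(2) lower_exponent_le[OF V] by (simp add: c_def)
  have gu: "1 + ln ((3 + V)\<^sup>2) / ln ?ph \<le> \<gamma>\<^sub>u" using assms(3) upper_exponent_le[OF V] by linarith
  have "(L \<ge> L\<^sub>0 \<longrightarrow> Cl * L powr \<gamma>\<^sub>l \<le> local_norm u L) \<and> local_norm u L \<le> Cu * L powr \<gamma>\<^sub>u"
    if L: "L \<ge> 1" and E: "E \<in> fib_spectrum V" and u: "is_solution V \<omega> E u" "(norm (u 0))\<^sup>2 + (norm (u 1))\<^sup>2 = 1"
    for \<omega> L E u
  proof -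
    \<comment> \<open>\<omega>' may differ from \<omega>, but the traces depend on E and V only, so
      their bound holds for solutions at every \<omega>.\<close>
    obtain \<omega>' where "E \<in> spectrum (fib_hamiltonian V \<omega>')" using E by (auto simp: fib_spectrum_def)
    note spec = spectrum_real_trace_bound[OF V this]
    define e where "e = Re E"
    have sol: "is_solution V \<omega> (of_real e) u" using u(1) spec(1) by (simp add: e_def)
    have tr: "\<bar>fib_trace e V k\<bar> \<le> 2 + V" for k unfolding e_def by (rule spec(2))
    have "local_norm u L \<le> Cu * L powr (1 + ln ((3 + V)\<^sup>2) / ln ?ph)"
      unfolding Cu_def by (rule local_norm_upper[OF V tr sol u(2) L])
    also have "\<dots> \<le> Cu * L powr \<gamma>\<^sub>u" using Cu gu L by (intro mult_left_mono powr_mono) auto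
    finally have up: "local_norm u L \<le> Cu * L powr \<gamma>\<^sub>u" .
    have "Cl * L powr \<gamma>\<^sub>l \<le> local_norm u L" if "L \<ge> L\<^sub>0"
    proof -
      have "Cl * L powr \<gamma>\<^sub>l \<le> Cl * L powr (ln c / (12 * ln ?ph))"
        using Cl gl L by (intro mult_left_mono powr_mono) auto
      also have "\<dots> \<le> local_norm u L"
        unfolding Cl_def c_def d_def by (rule local_norm_lower[OF V tr sol u(2) L assms(4) that])
      finally show ?thesis .
    qed
    with up show ?thesis by blast
  qed
  with Cl Cu show ?thesis by blast
qed

end
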